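(* Let $A$ and $B$ be positive semidefinite matrices of the same size and let $C=(A^{1/2}BA^{1/2})^{1/2}$. Then $$\operatorname{tr}(e^{-A}e^{-B})\le \operatorname{tr}(e^{-A}+e^{-B})+\operatorname{tr}(e^{-2C}-2e^{-C}).$$ *)

theory Defs
  imports "Jordan_Normal_Form.Matrix"
begin

definition hermitian_mat :: "nat \<Rightarrow> complex mat \<Rightarrow> bool" where
  "hermitian_mat n A \<longleftrightarrow> A \<in> carrier_mat n n \<and>
     (\<forall>i<n. \<forall>j<n. A $$ (i, j) = cnj (A $$ (j, i)))"

definition psd_mat :: "nat \<Rightarrow> complex mat \<Rightarrow> bool" where
  "psd_mat n A \<longleftrightarrow> hermitian_mat n A \<and>
     (\<forall>v :: nat \<Rightarrow> complex. 0 \<le> Re (\<Sum>i<n. \<Sum>j<n. cnj (v i) * A $$ (i, j) * v j))"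

definition mat_exp :: "nat \<Rightarrow> complex mat \<Rightarrow> complex mat" where
  "mat_exp n A = mat n n (\<lambda>(i, j). \<Sum>k. (A ^\<^sub>m k) $$ (i, j) / of_real (fact k))"

definition mat_sqrt :: "nat \<Rightarrow> complex mat \<Rightarrow> complex mat" where
  "mat_sqrt n A = (THE S. psd_mat n S \<and> S * S = A)"

definition mat_tr :: "nat \<Rightarrow> complex mat \<Rightarrow> complex" where
  "mat_tr n A = (\<Sum>i<n. A $$ (i, i))"

end

theory Submission
  imports Defs "Jordan_Normal_Form.Spectral_Radius"
    "HOL-Analysis.Convex" "HOL-Analysis.Elementary_Metric_Spaces"
begin

text \<open>With \<open>f x = 1 - exp (- x)\<close> the claim reads \<open>tr (f A * f B) \<le> tr ((f C)\<^sup>2)\<close>. It follows from the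
  weak log-majorization of the eigenvalues of \<open>(f A)\<^sup>1\<^sup>/\<^sup>2 * f B * (f A)\<^sup>1\<^sup>/\<^sup>2\<close> by the numbers \<open>(f c)\<^sup>2\<close>, where
  \<open>c\<close> runs through the eigenvalues of \<open>C\<close>. This majorization holds for the truncations \<open>min x s\<close> by
  the minimax principle. Since both sides are controlled by Gram determinants, for which a
  Cauchy-Schwarz inequality holds, it passes from \<open>p\<close> and \<open>q\<close> to \<open>sqrt (p * q)\<close>, hence by continuity to
  all weighted geometric means. Finally \<open>ln (f (exp t))\<close> is concave with slopes between 0 and 1, so on the
  finitely many eigenvalues involved \<open>f\<close> is a multiple of a weighted geometric mean of truncations.\<close>

text \<open>The reduction to \<open>f\<close> is an expansion: the trace of
  \<open>(1 - exp (-A)) * (1 - exp (-B))\<close> produces the left side and the first trace on the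
  right, while \<open>(1 - exp (-c))^2 = 1 + exp (-2c) - 2 exp (-c)\<close> produces the last one;
  the two constants \<open>n\<close> cancel. For truncations the minimax argument compares each
  single eigenvalue. The step to \<open>sqrt (p * q)\<close> controls only the product of the
  \<open>k\<close> leading eigenvalues, because its Cauchy-Schwarz inequality lives in the
  \<open>k\<close>-th exterior power. This is why domination is stated for all \<open>k\<close> and
  all matrices with \<open>k\<close> columns. Exterior powers are never formed: the minors of such a
  matrix serve as coordinates. Truncations are the right building blocks because
  \<open>ln (min x s) = min (ln x) (ln s)\<close>. Combinations of these with nonnegative weights of
  sum 1 are, up to a constant, the concave piecewise linear functions of \<open>ln x\<close> with
  slope 1 far to the left and slope 0 far to the right. Slopes in \<open>[0, 1]\<close> are exactly
  what makes the interpolating weights nonnegative with sum 1.\<close>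

notation mat_adjoint ("_\<^sup>\<dagger>" [1000] 999)

section \<open>Matrix entries and adjoints\<close>

lemma index_mult_mat_sum:
  assumes "A \<in> carrier_mat m k" "B \<in> carrier_mat k l" "i < m" "j < l"
  shows "(A * B) $$ (i, j) = (\<Sum>r<k. A $$ (i, r) * B $$ (r, j))"
  using assms by (simp add: scalar_prod_def atLeast0LessThan)

lemma adjoint_carrier [simp, intro]:
  "A \<in> carrier_mat m k \<Longrightarrow> A\<^sup>\<dagger> \<in> carrier_mat k m"
  unfolding mat_adjoint_def by (auto simp: mat_of_rows_def)

lemma adjoint_dim [simp]: "dim_row (A\<^sup>\<dagger>) = dim_col A" "dim_col (A\<^sup>\<dagger>) = dim_row A"
  unfolding mat_adjoint_def by auto

lemma index_adjoint [simp]: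
  fixes A :: "complex mat"
  assumes "i < dim_col A" "j < dim_row A"
  shows "A\<^sup>\<dagger> $$ (i, j) = cnj (A $$ (j, i))"
  using assms unfolding mat_adjoint_def by (simp add: mat_of_rows_def)

lemma adjoint_adjoint [simp]: "((A :: complex mat)\<^sup>\<dagger>)\<^sup>\<dagger> = A"
  by (rule eq_matI) auto

lemma adjoint_one [simp]: "(1\<^sub>m n :: complex mat)\<^sup>\<dagger> = 1\<^sub>m n"
  by (rule eq_matI) auto

lemma adjoint_mult:
  fixes A B :: "complex mat"
  assumes A: "A \<in> carrier_mat m k" and B: "B \<in> carrier_mat k l"
  shows "(A * B)\<^sup>\<dagger> = B\<^sup>\<dagger> * A\<^sup>\<dagger>"
proof (rule eq_matI)
  fix i j assume "i < dim_row (B\<^sup>\<dagger> * A\<^sup>\<dagger>)" "j < dim_col (B\<^sup>\<dagger> * A\<^sup>\<dagger>)"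
  hence ij: "i < l" "j < m" using A B by auto
  have "(A * B)\<^sup>\<dagger> $$ (i, j) = cnj ((A * B) $$ (j, i))" using A B ij by simp
  also have "\<dots> = (B\<^sup>\<dagger> * A\<^sup>\<dagger>) $$ (i, j)"
    using A B ij
    by (subst (1 2) index_mult_mat_sum[of _ _ k]) (auto intro!: sum.cong simp: mult.commute)
  finally show "(A * B)\<^sup>\<dagger> $$ (i, j) = (B\<^sup>\<dagger> * A\<^sup>\<dagger>) $$ (i, j)" .
qed (use A B in auto)

subsection \<open>Gram determinants\<close>

text \<open>Plucker coordinates of the columns of \<open>P\<close>, indexed by arbitrary maps
  instead of increasing ones: a repeated row gives 0, a reordering of the rows only changes the
  sign.\<close>

definition row_minor :: "nat \<Rightarrow> complex mat \<Rightarrow> (nat \<Rightarrow> nat) \<Rightarrow> complex" where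
  "row_minor k P f = det (mat k k (\<lambda>(i, j). P $$ (f i, j)))"

lemma row_minor_permute:
  assumes "p permutes {..<k}"
  shows "row_minor k P (\<lambda>i. f (p i)) = signof p * row_minor k P f"
proof -
  have "mat k k (\<lambda>(i, j). P $$ (f (p i), j)) =
      mat k k (\<lambda>(i, j). mat k k (\<lambda>(i, j). P $$ (f i, j)) $$ (p i, j))"
    using assms permutes_in_image[of p "{..<k}"] by (intro eq_matI) auto
  with assms show ?thesis
    unfolding row_minor_def
    by (simp add: det_permute_rows[of "mat k k (\<lambda>(i, j). P $$ (f i, j))"] atLeast0LessThan)
qed

lemma row_minor_cong:
  "(\<And>i j. i < k \<Longrightarrow> j < k \<Longrightarrow> P $$ (f i, j) = Q $$ (g i, j)) \<Longrightarrow> row_minor k P f = row_minor k Q g"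
  unfolding row_minor_def by (rule arg_cong[where f = det]) (auto intro!: eq_matI)

lemma row_minor_eq_0:
  assumes "\<not> inj_on f {..<k}"
  shows "row_minor k P f = 0"
proof -
  from assms obtain i j where ij: "i < k" "j < k" "i \<noteq> j" "f i = f j"
    by (auto simp: inj_on_def)
  show ?thesis unfolding row_minor_def
    by (rule det_identical_rows[of _ k i j]) (use ij in \<open>auto intro!: eq_vecI\<close>)
qed

text \<open>One half of the Cauchy-Binet formula: distributing the product over the inner sums turns
  the Leibniz expansion into a sum over all maps \<open>f\<close>, and for fixed \<open>f\<close>
  the sum over permutations is a minor of \<open>Q\<close>. The factor from \<open>P\<close> is
  still a bare product.\<close>

lemma det_adjoint_mult_sum:
  assumes P: "P \<in> carrier_mat n k" and Q: "Q \<in> carrier_mat n k"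
  shows "det (P\<^sup>\<dagger> * Q) =
    (\<Sum>f\<in>PiE {..<k} (\<lambda>_. {..<n}). (\<Prod>i<k. cnj (P $$ (f i, i))) * row_minor k Q f)"
proof -
  let ?F = "PiE {..<k} (\<lambda>_. {..<n})" and ?S = "{p. p permutes {..<k}}"
  have entry: "(P\<^sup>\<dagger> * Q) $$ (i, p i) = (\<Sum>r<n. cnj (P $$ (r, i)) * Q $$ (r, p i))"
    if "p \<in> ?S" "i < k" for p i
  proof -
    have "p i < k" using that permutes_in_image[of p "{..<k}" i] by auto
    thus ?thesis using that P Q by (subst index_mult_mat_sum[of _ k n _ k]) auto
  qed
  have "det (P\<^sup>\<dagger> * Q) = (\<Sum>p\<in>?S. signof p * (\<Prod>i<k. (P\<^sup>\<dagger> * Q) $$ (i, p i)))"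
    using P Q by (subst det_def'[of _ k]) (auto simp: atLeast0LessThan)
  also have "\<dots> = (\<Sum>p\<in>?S. signof p * (\<Prod>i<k. \<Sum>r<n. cnj (P $$ (r, i)) * Q $$ (r, p i)))"
    by (intro sum.cong refl arg_cong2[where f = "(*)"] prod.cong) (use entry in auto)
  also have "\<dots> = (\<Sum>p\<in>?S. \<Sum>f\<in>?F. signof p * (\<Prod>i<k. cnj (P $$ (f i, i)) * Q $$ (f i, p i)))"
    by (subst prod_sum_PiE) (auto simp: sum_distrib_left)
  also have "\<dots> = (\<Sum>f\<in>?F. \<Sum>p\<in>?S. signof p * (\<Prod>i<k. cnj (P $$ (f i, i)) * Q $$ (f i, p i)))"
    by (rule sum.swap)
  also have "\<dots> = (\<Sum>f\<in>?F. (\<Prod>i<k. cnj (P $$ (f i, i))) * row_minor k Q f)"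
  proof (rule sum.cong[OF refl])
    fix f assume "f \<in> ?F"
    have "row_minor k Q f = (\<Sum>p\<in>?S. signof p * (\<Prod>i<k. Q $$ (f i, p i)))"
      unfolding row_minor_def
      by (subst det_def'[of _ k])
         (auto simp: atLeast0LessThan intro!: sum.cong prod.cong dest: permutes_in_image)
    thus "(\<Sum>p\<in>?S. signof p * (\<Prod>i<k. cnj (P $$ (f i, i)) * Q $$ (f i, p i))) =
        (\<Prod>i<k. cnj (P $$ (f i, i))) * row_minor k Q f"
      by (simp add: prod.distrib sum_distrib_left mult_ac)
  qed
  finally show ?thesis .
qed

text \<open>Summing over all index maps instead of increasing ones costs the factor \<open>fact k\<close>,
  but avoids choosing representatives.\<close>

lemma Cauchy_Binet_all_maps:
  assumes P: "P \<in> carrier_mat n k" and Q: "Q \<in> carrier_mat n k"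
  shows "fact k * det (P\<^sup>\<dagger> * Q) =
    (\<Sum>f\<in>PiE {..<k} (\<lambda>_. {..<n}). cnj (row_minor k P f) * row_minor k Q f)"
proof -
  let ?F = "PiE {..<k} (\<lambda>_. {..<n})" and ?S = "{p. p permutes {..<k}}"
  let ?g = "\<lambda>f. (\<Prod>i<k. cnj (P $$ (f i, i))) * row_minor k Q f"
  \<comment> \<open>Replacing \<open>f\<close> by its composition with \<open>p\<close> permutes the
    index set and changes the minor of \<open>Q\<close> by the sign of \<open>p\<close>. Adding
    these identities over all \<open>p\<close> assembles the products of entries of \<open>P\<close>
    into a minor and counts the determinant \<open>fact k\<close> times.\<close>
  have reindex: "det (P\<^sup>\<dagger> * Q) =
      (\<Sum>f\<in>?F. signof p * (\<Prod>i<k. cnj (P $$ (f (p i), i))) * row_minor k Q f)" if p: "p \<in> ?S" for p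
  proof -
    let ?h = "\<lambda>q f. restrict (\<lambda>i. f (q i)) {..<k}"
    have q: "Hilbert_Choice.inv p permutes {..<k}" using p by (simp add: permutes_inv)
    have mem: "?h r f \<in> ?F" if "f \<in> ?F" "r permutes {..<k}" for f r
      using that by (auto simp: PiE_iff permutes_in_image[OF that(2)] dest: permutes_in_image)
    have inv: "?h r (?h s f) = f" if "f \<in> ?F" "r permutes {..<k}" "\<And>i. s (r i) = i" for f r s
      using that permutes_in_image[OF that(2)] by (auto simp: fun_eq_iff PiE_iff extensional_def)
    have "det (P\<^sup>\<dagger> * Q) = (\<Sum>f\<in>?F. ?g f)"
      by (rule det_adjoint_mult_sum[OF P Q])
    also have "\<dots> = (\<Sum>f\<in>?F. ?g (?h p f))"
      by (rule sum.reindex_bij_witness[of _ "?h p" "?h (Hilbert_Choice.inv p)"])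
         (use p q mem inv in \<open>auto simp: permutes_inverses\<close>)
    also have "\<dots> = (\<Sum>f\<in>?F. signof p * (\<Prod>i<k. cnj (P $$ (f (p i), i))) * row_minor k Q f)"
    proof (rule sum.cong[OF refl])
      fix f
      have "row_minor k Q (?h p f) = row_minor k Q (\<lambda>i. f (p i))"
        by (rule row_minor_cong) auto
      also have "\<dots> = signof p * row_minor k Q f"
        using p by (simp add: row_minor_permute)
      finally show "?g (?h p f) = signof p * (\<Prod>i<k. cnj (P $$ (f (p i), i))) * row_minor k Q f"
        by (simp add: mult_ac)
    qed
    finally show ?thesis .
  qed
  have minor: "(\<Sum>p\<in>?S. signof p * (\<Prod>i<k. cnj (P $$ (f (p i), i)))) = cnj (row_minor k P f)" for f
  proof -
    have "row_minor k P f = (\<Sum>p\<in>?S. signof p * (\<Prod>i<k. P $$ (f (p i), i)))"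
      unfolding row_minor_def
      by (subst det_col[of _ k])
         (auto simp: atLeast0LessThan intro!: sum.cong prod.cong dest: permutes_in_image)
    thus ?thesis by (simp add: sign_def) 
  qed
  have "fact k * det (P\<^sup>\<dagger> * Q) = (\<Sum>p\<in>?S. det (P\<^sup>\<dagger> * Q))"
    by (simp add: card_permutations)
  also have "\<dots> = (\<Sum>p\<in>?S. \<Sum>f\<in>?F. signof p * (\<Prod>i<k. cnj (P $$ (f (p i), i))) * row_minor k Q f)"
    by (intro sum.cong refl reindex)
  also have "\<dots> = (\<Sum>f\<in>?F. \<Sum>p\<in>?S. signof p * (\<Prod>i<k. cnj (P $$ (f (p i), i))) * row_minor k Q f)"
    by (rule sum.swap)
  also have "\<dots> = (\<Sum>f\<in>?F. cnj (row_minor k P f) * row_minor k Q f)"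
    by (simp add: minor flip: sum_distrib_right)
  finally show ?thesis .
qed

text \<open>For equal factors the Cauchy-Binet terms are squared moduli, so the Gram determinant is
  a nonnegative real and taking \<open>cmod\<close> loses nothing.\<close>

lemma det_gram_eq:
  assumes P: "P \<in> carrier_mat n k"
  shows "fact k * cmod (det (P\<^sup>\<dagger> * P)) =
    (\<Sum>f\<in>PiE {..<k} (\<lambda>_. {..<n}). (cmod (row_minor k P f))\<^sup>2)"
proof -
  let ?F = "PiE {..<k} (\<lambda>_. {..<n})"
  have "fact k * det (P\<^sup>\<dagger> * P) = of_real (\<Sum>f\<in>?F. (cmod (row_minor k P f))\<^sup>2)"
    unfolding Cauchy_Binet_all_maps[OF P P] of_real_sum
    by (intro sum.cong refl) (simp only: complex_norm_square mult.commute)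
  hence "cmod (fact k * det (P\<^sup>\<dagger> * P)) = (\<Sum>f\<in>?F. (cmod (row_minor k P f))\<^sup>2)"
    by (simp add: sum_nonneg del: of_real_sum)
  thus ?thesis by (simp add: norm_mult)
qed

text \<open>The ordinary Cauchy-Schwarz inequality for the vectors of all minors of \<open>P\<close>
  and of \<open>Q\<close>; the factors \<open>fact k\<close> cancel.\<close>

lemma det_Cauchy_Schwarz:
  assumes P: "P \<in> carrier_mat n k" and Q: "Q \<in> carrier_mat n k"
  shows "(cmod (det (P\<^sup>\<dagger> * Q)))\<^sup>2 \<le> cmod (det (P\<^sup>\<dagger> * P)) * cmod (det (Q\<^sup>\<dagger> * Q))"
proof -
  let ?F = "PiE {..<k} (\<lambda>_. {..<n})"
  have "fact k * cmod (det (P\<^sup>\<dagger> * Q)) = cmod (fact k * det (P\<^sup>\<dagger> * Q))"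
    by (simp add: norm_mult)
  also have "\<dots> \<le> (\<Sum>f\<in>?F. cmod (row_minor k P f) * cmod (row_minor k Q f))"
    unfolding Cauchy_Binet_all_maps[OF P Q]
    by (rule order_trans[OF norm_sum]) (simp add: norm_mult)
  finally have "(fact k * cmod (det (P\<^sup>\<dagger> * Q)))\<^sup>2 \<le>
      (\<Sum>f\<in>?F. cmod (row_minor k P f) * cmod (row_minor k Q f))\<^sup>2"
    by (intro power_mono) auto
  also have "\<dots> \<le> (\<Sum>f\<in>?F. (cmod (row_minor k P f))\<^sup>2) * (\<Sum>f\<in>?F. (cmod (row_minor k Q f))\<^sup>2)"
    by (rule Cauchy_Schwarz_ineq_sum)
  also have "\<dots> = (fact k)\<^sup>2 * (cmod (det (P\<^sup>\<dagger> * P)) * cmod (det (Q\<^sup>\<dagger> * Q)))"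
    unfolding det_gram_eq[OF P, symmetric] det_gram_eq[OF Q, symmetric]
    by (simp add: power2_eq_square)
  finally show ?thesis by (simp add: power_mult_distrib)
qed

section \<open>Real diagonal matrices and their compressions\<close>

definition rdiag :: "nat \<Rightarrow> (nat \<Rightarrow> real) \<Rightarrow> complex mat" where
  "rdiag n d = mat n n (\<lambda>(i, j). if i = j then of_real (d i) else 0)"

lemma rdiag_carrier [simp, intro]: "rdiag n d \<in> carrier_mat n n"
  by (simp add: rdiag_def)

lemma rdiag_dim [simp]: "dim_row (rdiag n d) = n" "dim_col (rdiag n d) = n"
  by (simp_all add: rdiag_def)

lemma index_rdiag [simp]:
  "i < n \<Longrightarrow> j < n \<Longrightarrow> rdiag n d $$ (i, j) = (if i = j then of_real (d i) else 0)"
  by (simp add: rdiag_def)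

lemma index_rdiag_mult:
  assumes "Q \<in> carrier_mat n k" "i < n" "j < k"
  shows "(rdiag n d * Q) $$ (i, j) = of_real (d i) * Q $$ (i, j)"
  using assms by (subst index_mult_mat_sum[of _ n n _ k]) (auto simp: if_distrib if_distribR cong: if_cong)

lemma index_mult_rdiag:
  assumes "Q \<in> carrier_mat k n" "i < k" "j < n"
  shows "(Q * rdiag n d) $$ (i, j) = Q $$ (i, j) * of_real (d j)"
  using assms by (subst index_mult_mat_sum[of _ k n _ n]) (auto simp: if_distrib if_distribR cong: if_cong)

lemma rdiag_adjoint [simp]: "(rdiag n d)\<^sup>\<dagger> = rdiag n d"
  by (rule eq_matI) auto

lemma rdiag_mult: "rdiag n d * rdiag n e = rdiag n (\<lambda>i. d i * e i)"
  by (rule eq_matI) (auto simp: index_rdiag_mult[of _ _ n] simp del: index_mult_mat(1))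

lemma det_rdiag: "det (rdiag n d) = (\<Prod>i<n. of_real (d i))"
proof -
  have "diag_mat (rdiag n d) = map (\<lambda>i. of_real (d i)) [0..<n]"
    by (auto simp: diag_mat_def)
  moreover have "det (rdiag n d) = prod_list (diag_mat (rdiag n d))"
    by (rule det_upper_triangular[of _ n]) auto
  ultimately show ?thesis
    by (simp add: prod.list_conv_set_nth atLeast0LessThan)
qed

text \<open>The largest element \<open>m\<close> of a set of \<open>k + 1\<close> indices is at
  least \<open>k\<close>, so \<open>d m \<le> d k\<close>; removing it leaves a set of
  \<open>k\<close> indices for the induction.\<close>

lemma prod_antimono_le:
  fixes d :: "nat \<Rightarrow> real"
  assumes "finite I" "I \<subseteq> {..<n}" "card I = k"
    and "\<And>i. i < n \<Longrightarrow> 0 \<le> d i" "\<And>i j. i \<le> j \<Longrightarrow> j < n \<Longrightarrow> d j \<le> d i"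
  shows "prod d I \<le> (\<Prod>i<k. d i)"
  using assms(1-3)
proof (induction k arbitrary: I)
  case (Suc k)
  define m where "m = Max I"
  have ne: "I \<noteq> {}" using Suc.prems by auto
  have m: "m \<in> I" "\<And>i. i \<in> I \<Longrightarrow> i \<le> m" using ne Suc.prems by (auto simp: m_def)
  have "I \<subseteq> {..m}" using m by auto
  hence "Suc k \<le> Suc m" using card_mono[of "{..m}" I] Suc.prems by simp
  hence km: "k \<le> m" "m < n" using Suc.prems m by auto
  have "prod d I = d m * prod d (I - {m})"
    using m Suc.prems by (intro prod.remove) auto
  also have "\<dots> \<le> d k * (\<Prod>i<k. d i)"
    using Suc.prems m km
    by (intro mult_mono Suc.IH) (auto intro!: assms(4,5) prod_nonneg)
  finally show ?case by (simp add: mult.commute)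
qed simp

text \<open>A diagonal factor multiplies the minor with rows \<open>f\<close> by the product of
  \<open>d\<close> over these rows. Only injective \<open>f\<close> contribute, and \<open>k\<close>
  distinct indices have product at most that of the first \<open>k\<close>. In exterior power terms,
  the leading product is the largest eigenvalue.\<close>

lemma det_compression_le:
  assumes E: "E \<in> carrier_mat n k"
    and d: "\<And>i. i < n \<Longrightarrow> 0 \<le> d i" "\<And>i j. i \<le> j \<Longrightarrow> j < n \<Longrightarrow> d j \<le> d i"
  shows "cmod (det (E\<^sup>\<dagger> * (rdiag n d * E))) \<le> (\<Prod>i<k. d i) * cmod (det (E\<^sup>\<dagger> * E))"
proof -
  let ?F = "PiE {..<k} (\<lambda>_. {..<n})"
  have DE: "rdiag n d * E \<in> carrier_mat n k" using E by auto
  have le: "cmod (row_minor k (rdiag n d * E) f) \<le> (\<Prod>i<k. d i) * cmod (row_minor k E f)"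
    if f: "f \<in> ?F" for f
  proof (cases "inj_on f {..<k}")
    case True
    have "row_minor k (rdiag n d * E) f =
        (\<Sum>p | p permutes {..<k}. signof p * (\<Prod>i<k. of_real (d (f i)) * E $$ (f i, p i)))"
      unfolding row_minor_def
      using f E permutes_in_image[of _ "{..<k}"]
      by (subst det_def'[of _ k])
         (auto simp: atLeast0LessThan PiE_iff index_rdiag_mult[OF E] simp del: index_mult_mat(1) intro!: sum.cong prod.cong)
    also have "\<dots> = (\<Prod>i<k. of_real (d (f i))) *
        (\<Sum>p | p permutes {..<k}. signof p * (\<Prod>i<k. E $$ (f i, p i)))"
      by (simp add: prod.distrib sum_distrib_left mult_ac)
    also have "(\<Sum>p | p permutes {..<k}. signof p * (\<Prod>i<k. E $$ (f i, p i))) = row_minor k E f"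
      unfolding row_minor_def
      using permutes_in_image[of _ "{..<k}"]
      by (subst det_def'[of _ k])
         (auto simp: atLeast0LessThan intro!: sum.cong prod.cong)
    finally have "cmod (row_minor k (rdiag n d * E) f) =
        (\<Prod>i<k. \<bar>d (f i)\<bar>) * cmod (row_minor k E f)"
      by (simp add: norm_mult prod_norm[symmetric])
    also have "(\<Prod>i<k. \<bar>d (f i)\<bar>) = prod d (f ` {..<k})"
      using f True d(1) by (subst prod.reindex) (auto simp: PiE_iff intro!: prod.cong)
    also have "prod d (f ` {..<k}) \<le> (\<Prod>i<k. d i)"
      using f True d by (intro prod_antimono_le[of _ n]) (auto simp: card_image)
    finally show ?thesis by (simp add: mult_right_mono)
  qed (simp add: row_minor_eq_0)
  have "fact k * cmod (det (E\<^sup>\<dagger> * (rdiag n d * E))) = cmod (fact k * det (E\<^sup>\<dagger> * (rdiag n d * E)))"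
    by (simp add: norm_mult)
  also have "\<dots> \<le> (\<Sum>f\<in>?F. cmod (row_minor k E f) * cmod (row_minor k (rdiag n d * E) f))"
    unfolding Cauchy_Binet_all_maps[OF E DE]
    by (rule order_trans[OF norm_sum]) (simp add: norm_mult)
  also have "\<dots> \<le> (\<Sum>f\<in>?F. cmod (row_minor k E f) * ((\<Prod>i<k. d i) * cmod (row_minor k E f)))"
    by (intro sum_mono mult_left_mono le) auto
  also have "\<dots> = (\<Prod>i<k. d i) * (\<Sum>f\<in>?F. (cmod (row_minor k E f))\<^sup>2)"
    by (simp add: sum_distrib_left power2_eq_square mult_ac)
  also have "\<dots> = fact k * ((\<Prod>i<k. d i) * cmod (det (E\<^sup>\<dagger> * E)))"
    by (simp flip: det_gram_eq[OF E])
  finally show ?thesis by simp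
qed

subsection \<open>Spectral decomposition\<close>

definition unitary_mat :: "nat \<Rightarrow> complex mat \<Rightarrow> bool" where
  "unitary_mat n U \<longleftrightarrow> U \<in> carrier_mat n n \<and> U\<^sup>\<dagger> * U = 1\<^sub>m n"

lemma unitary_carrier: "unitary_mat n U \<Longrightarrow> U \<in> carrier_mat n n"
  by (simp add: unitary_mat_def)

lemma unitary_left: "unitary_mat n U \<Longrightarrow> U\<^sup>\<dagger> * U = 1\<^sub>m n"
  by (simp add: unitary_mat_def)

lemma unitary_right: "unitary_mat n U \<Longrightarrow> U * U\<^sup>\<dagger> = 1\<^sub>m n"
  unfolding unitary_mat_def by (rule mat_mult_left_right_inverse) auto

lemma unitary_mult:
  assumes "unitary_mat n U" "unitary_mat n V"
  shows "unitary_mat n (U * V)"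
proof -
  have c: "U \<in> carrier_mat n n" "V \<in> carrier_mat n n" using assms by (auto simp: unitary_mat_def)
  have "(U * V)\<^sup>\<dagger> * (U * V) = V\<^sup>\<dagger> * (U\<^sup>\<dagger> * (U * V))"
    using c by (simp add: adjoint_mult[of _ n n _ n] assoc_mult_mat[of _ n n _ n _ n])
  also have "U\<^sup>\<dagger> * (U * V) = (U\<^sup>\<dagger> * U) * V"
    using c by (simp add: assoc_mult_mat[of _ n n _ n _ n])
  finally show ?thesis
    using c assms by (simp add: unitary_mat_def)
qed

text \<open>Functional calculus with the eigenbasis kept as data: every function of a hermitian
  matrix that occurs later is obtained by changing \<open>d\<close> while \<open>U\<close> stays
  fixed.\<close>

definition spec_mat :: "nat \<Rightarrow> complex mat \<Rightarrow> (nat \<Rightarrow> real) \<Rightarrow> complex mat" where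
  "spec_mat n U d = U * (rdiag n d * U\<^sup>\<dagger>)"

lemma spec_mat_carrier [simp, intro]: "U \<in> carrier_mat n n \<Longrightarrow> spec_mat n U d \<in> carrier_mat n n"
  unfolding spec_mat_def by (meson adjoint_carrier mult_carrier_mat rdiag_carrier)

lemma spec_mat_dim [simp]: "dim_row (spec_mat n U d) = dim_row U" "dim_col (spec_mat n U d) = dim_row U"
  by (simp_all add: spec_mat_def)

lemma index_spec_mat:
  assumes U: "U \<in> carrier_mat n n" and ij: "i < n" "j < n"
  shows "spec_mat n U d $$ (i, j) = (\<Sum>l<n. U $$ (i, l) * of_real (d l) * cnj (U $$ (j, l)))"
proof -
  have "rdiag n d * U\<^sup>\<dagger> \<in> carrier_mat n n"
    using U by (meson adjoint_carrier mult_carrier_mat rdiag_carrier)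
  thus ?thesis unfolding spec_mat_def
    using U ij
    by (subst index_mult_mat_sum[of _ n n _ n])
       (auto simp: index_rdiag_mult[of _ n n] simp del: index_mult_mat(1) intro!: sum.cong)
qed

lemma spec_mat_cong:
  assumes "U \<in> carrier_mat n n" "\<And>i. i < n \<Longrightarrow> d i = e i"
  shows "spec_mat n U d = spec_mat n U e"
proof -
  have "rdiag n d = rdiag n e" using assms by (auto simp: rdiag_def)
  thus ?thesis by (simp add: spec_mat_def)
qed

lemma spec_mat_adjoint:
  assumes U: "U \<in> carrier_mat n n"
  shows "(spec_mat n U d)\<^sup>\<dagger> = spec_mat n U d"
proof -
  have c: "rdiag n d * U\<^sup>\<dagger> \<in> carrier_mat n n"
    using U by (meson adjoint_carrier mult_carrier_mat rdiag_carrier)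
  show ?thesis
    unfolding spec_mat_def using U c
    by (simp add: adjoint_mult[of _ n n _ n] assoc_mult_mat[of _ n n _ n _ n])
qed

lemma spec_mat_mult:
  assumes "unitary_mat n U"
  shows "spec_mat n U d * spec_mat n U e = spec_mat n U (\<lambda>i. d i * e i)"
proof -
  note U = unitary_carrier[OF assms]
  have c: "rdiag n e * U\<^sup>\<dagger> \<in> carrier_mat n n" for e
    using U by (meson adjoint_carrier mult_carrier_mat rdiag_carrier)
  have "spec_mat n U d * spec_mat n U e = U * (rdiag n d * ((U\<^sup>\<dagger> * U) * (rdiag n e * U\<^sup>\<dagger>)))"
    unfolding spec_mat_def using U c
    by (simp add: assoc_mult_mat[of _ n n _ n _ n] mult_carrier_mat[of _ n n _ n])
  also have "\<dots> = U * ((rdiag n d * rdiag n e) * U\<^sup>\<dagger>)"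
    using U c by (simp add: unitary_left[OF assms] assoc_mult_mat[of _ n n _ n _ n])
  finally show ?thesis by (simp add: rdiag_mult spec_mat_def)
qed

lemma spec_mat_one:
  assumes "unitary_mat n U"
  shows "spec_mat n U (\<lambda>_. 1) = 1\<^sub>m n"
proof -
  have "rdiag n (\<lambda>_. 1) = 1\<^sub>m n" by (auto simp: rdiag_def intro!: eq_matI)
  thus ?thesis
    using unitary_carrier[OF assms] unitary_right[OF assms] by (simp add: spec_mat_def)
qed

text \<open>Gram-Schmidt applied to a basis beginning with \<open>v\<close> leaves \<open>v\<close>
  in front. It yields orthogonal but unnormalized vectors, so the columns are divided by their
  norms; this is the origin of the factor \<open>c\<close>.\<close>

lemma unitary_with_first_col:
  fixes v :: "complex vec"
  assumes v: "v \<in> carrier_vec n" and v0: "v \<noteq> 0\<^sub>v n"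
  obtains W c where "unitary_mat n W" "\<And>i. i < n \<Longrightarrow> W $$ (i, 0) = c * v $ i"
proof -
  interpret cof_vec_space n "TYPE(complex)" .
  define b where "b = basis_completion v"
  define ws where "ws = gram_schmidt n b"
  have n: "n \<noteq> 0" using v v0 by auto
  have span_b: "span (set b) = carrier_vec n" and dist_b: "distinct b"
    and indep: "\<not> lin_dep (set b)" and b: "set b \<subseteq> carrier_vec n" and hdb: "hd b = v"
    and len_b: "length b = n"
    using basis_completion[OF v v0, folded b_def] by auto
  from hdb len_b n obtain vs where bv: "b = v # vs" by (cases b) auto
  have ws: "set ws \<subseteq> carrier_vec n" "corthogonal ws" "length ws = n"
    using gram_schmidt_result[OF b dist_b indep refl, folded ws_def] by (auto simp: len_b)
  have "hd ws = v" using gram_schmidt_hd[OF v, of vs, folded bv] by (simp add: ws_def)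
  hence ws0: "ws ! 0 = v" using ws(3) n by (subst hd_conv_nth[symmetric]) auto
  have dim: "dim_vec (ws ! i) = n" if "i < n" for i
    using that ws by (metis carrier_vecD nth_mem subsetD)
  define N where "N i = sqrt (\<Sum>r<n. (cmod (ws ! i $ r))\<^sup>2)" for i
  have gram: "(\<Sum>r<n. cnj (ws ! i $ r) * ws ! j $ r) = (if i = j then of_real ((N i)\<^sup>2) else 0)"
    "i = j \<Longrightarrow> N i \<noteq> 0"
    if "i < n" "j < n" for i j
  proof -
    have eq: "(\<Sum>r<n. cnj (ws ! i $ r) * ws ! j $ r) = ws ! j \<bullet>c ws ! i"
      using that dim by (auto simp: scalar_prod_def atLeast0LessThan mult.commute intro!: sum.cong)
    have z: "(ws ! j \<bullet>c ws ! i = 0) = (j \<noteq> i)"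
      using corthogonalD[OF ws(2)] that ws(3) by auto
    have sq: "(\<Sum>r<n. cnj (ws ! i $ r) * ws ! i $ r) = of_real ((N i)\<^sup>2)"
    proof -
      have "(N i)\<^sup>2 = (\<Sum>r<n. (cmod (ws ! i $ r))\<^sup>2)" by (simp add: N_def sum_nonneg)
      thus ?thesis by (simp only: of_real_sum complex_norm_square mult.commute)
    qed
    show "(\<Sum>r<n. cnj (ws ! i $ r) * ws ! j $ r) = (if i = j then of_real ((N i)\<^sup>2) else 0)"
      using eq z sq by auto
    show "N i \<noteq> 0" if "i = j" using eq z sq that by auto
  qed
  define W where "W = mat n n (\<lambda>(i, j). ws ! j $ i / of_real (N j))"
  have "W\<^sup>\<dagger> * W = 1\<^sub>m n"
  proof (rule eq_matI)
    fix i j assume "i < dim_row (1\<^sub>m n :: complex mat)" "j < dim_col (1\<^sub>m n :: complex mat)"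
    hence ij: "i < n" "j < n" by auto
    have "(W\<^sup>\<dagger> * W) $$ (i, j) =
        (\<Sum>r<n. cnj (ws ! i $ r) * ws ! j $ r) / (of_real (N i) * of_real (N j))"
      using ij by (subst index_mult_mat_sum[of _ n n _ n]) (auto simp: W_def sum_divide_distrib)
    also have "\<dots> = 1\<^sub>m n $$ (i, j)"
      using gram[OF ij] ij by (auto simp: power2_eq_square)
    finally show "(W\<^sup>\<dagger> * W) $$ (i, j) = 1\<^sub>m n $$ (i, j)" .
  qed (auto simp: W_def)
  hence "unitary_mat n W" by (auto simp: unitary_mat_def W_def)
  moreover have "W $$ (i, 0) = (1 / of_real (N 0)) * v $ i" if "i < n" for i
    using that by (auto simp: W_def ws0)
  ultimately show thesis by (rule that)
qed

lemma exists_eigenvector: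
  fixes A :: "complex mat"
  assumes A: "A \<in> carrier_mat n n" and n: "0 < n"
  obtains v e where "v \<in> carrier_vec n" "v \<noteq> 0\<^sub>v n" "A *\<^sub>v v = e \<cdot>\<^sub>v v"
proof -
  obtain e where "eigenvalue A e" using spectrum_non_empty[OF A n] by (auto simp: spectrum_def)
  then obtain v where "eigenvector A v e" by (auto simp: eigenvalue_def)
  with A show thesis by (intro that[of v e]) (auto simp: eigenvector_def)
qed

text \<open>Deflation: in an orthonormal basis that starts with an eigenvector, the first column of
  the matrix vanishes below the corner, and by hermitian symmetry so does the first row to the right
  of it. The induction hypothesis diagonalizes the remaining block.\<close>

lemma spectral_decomposition:
  fixes A :: "complex mat"
  assumes "A \<in> carrier_mat n n" "A\<^sup>\<dagger> = A"
  shows "\<exists>U d. unitary_mat n U \<and> A = spec_mat n U d"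
  using assms
proof (induction n arbitrary: A)
  case 0
  have "unitary_mat 0 (1\<^sub>m 0)" by (simp add: unitary_mat_def)
  moreover have "A = spec_mat 0 (1\<^sub>m 0) (\<lambda>_. 0)"
    using 0 by (intro eq_matI) (auto simp: spec_mat_def)
  ultimately show ?case by blast
next
  case (Suc m)
  let ?n = "Suc m"
  note A = Suc.prems(1) and herm = Suc.prems(2)
  obtain v e where v: "v \<in> carrier_vec ?n" "v \<noteq> 0\<^sub>v ?n" and Av: "A *\<^sub>v v = e \<cdot>\<^sub>v v"
    using exists_eigenvector[OF A] by auto
  obtain W c where W: "unitary_mat ?n W" and Wc: "\<And>i. i < ?n \<Longrightarrow> W $$ (i, 0) = c * v $ i"
    using unitary_with_first_col[OF v] by blast
  note cW = unitary_carrier[OF W]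
  define A' where "A' = W\<^sup>\<dagger> * (A * W)"
  have cAW: "A * W \<in> carrier_mat ?n ?n" using A cW by auto
  have cA': "A' \<in> carrier_mat ?n ?n" using A cW by (auto simp: A'_def)
  have hA': "A'\<^sup>\<dagger> = A'"
    unfolding A'_def using A cW cAW herm
    by (simp add: adjoint_mult[of _ ?n ?n _ ?n] assoc_mult_mat[of _ ?n ?n _ ?n _ ?n])
  have AW0: "(A * W) $$ (r, 0) = e * W $$ (r, 0)" if r: "r < ?n" for r
  proof -
    have "(A * W) $$ (r, 0) = c * (\<Sum>s<?n. A $$ (r, s) * v $ s)"
      using r A cW unfolding sum_distrib_left
      by (subst index_mult_mat_sum[of _ ?n ?n _ ?n]) (auto simp: Wc mult_ac intro!: sum.cong simp del: sum.lessThan_Suc)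
    also have "(\<Sum>s<?n. A $$ (r, s) * v $ s) = (A *\<^sub>v v) $ r"
      using r A v by (auto simp: scalar_prod_def atLeast0LessThan intro!: sum.cong)
    finally show ?thesis using r v by (simp add: Av Wc)
  qed
  have A'0: "A' $$ (i, 0) = (if i = 0 then e else 0)" if i: "i < ?n" for i
  proof -
    have "A' $$ (i, 0) = (\<Sum>r<?n. e * (W\<^sup>\<dagger> $$ (i, r) * W $$ (r, 0)))"
      unfolding A'_def using i A cW cAW
      by (subst index_mult_mat_sum[of _ ?n ?n _ ?n]) (auto simp: AW0 mult_ac simp del: sum.lessThan_Suc index_mult_mat(1) intro!: sum.cong)
    also have "\<dots> = e * (W\<^sup>\<dagger> * W) $$ (i, 0)"
      using i cW
      by (subst index_mult_mat_sum[of _ ?n ?n _ ?n]) (auto simp: sum_distrib_left simp del: sum.lessThan_Suc)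
    finally show ?thesis using i by (simp add: unitary_left[OF W])
  qed
  have A'sym: "A' $$ (i, j) = cnj (A' $$ (j, i))" if "i < ?n" "j < ?n" for i j
    using that cA' by (subst hA'[symmetric]) simp
  have A'0r: "A' $$ (0, j) = (if j = 0 then e else 0)" if j: "j < ?n" for j
    using A'sym[of 0 j] A'0[OF j] A'0[of 0] j by auto
  have e: "e = of_real (Re e)"
    using A'sym[of 0 0] A'0[of 0] by (simp add: complex_eq_iff)
  define A3 where "A3 = mat m m (\<lambda>(i, j). A' $$ (Suc i, Suc j))"
  have "A3 \<in> carrier_mat m m" "A3\<^sup>\<dagger> = A3"
    by (auto simp: A3_def intro!: eq_matI A'sym[symmetric])
  then obtain U3 d3 where U3: "unitary_mat m U3" and A3: "A3 = spec_mat m U3 d3"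
    using Suc.IH by blast
  note cU3 = unitary_carrier[OF U3]
  \<comment> \<open>The block sum of the 1 by 1 identity and \<open>U3\<close>; accordingly
    \<open>d\<close> puts the split-off eigenvalue in front of \<open>d3\<close>. This eigenvalue is
    real because it is a diagonal entry of a hermitian matrix.\<close>
  define U4 where "U4 = mat ?n ?n (\<lambda>(i, j). case i of 0 \<Rightarrow> (case j of 0 \<Rightarrow> 1 | Suc _ \<Rightarrow> 0)
      | Suc i' \<Rightarrow> (case j of 0 \<Rightarrow> 0 | Suc j' \<Rightarrow> U3 $$ (i', j')))"
  define d where "d = case_nat (Re e) d3"
  have d_simps: "d 0 = Re e" "d (Suc l) = d3 l" for l by (simp_all add: d_def)
  have cU4: "U4 \<in> carrier_mat ?n ?n" by (simp add: U4_def)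
  have U4_00: "U4 $$ (0, 0) = 1" "\<And>i. i < m \<Longrightarrow> U4 $$ (Suc i, 0) = 0" "\<And>i. i < m \<Longrightarrow> U4 $$ (0, Suc i) = 0"
    "\<And>i j. i < m \<Longrightarrow> j < m \<Longrightarrow> U4 $$ (Suc i, Suc j) = U3 $$ (i, j)"
    by (auto simp: U4_def)
  have U4U4: "U4\<^sup>\<dagger> * U4 = 1\<^sub>m ?n"
  proof (rule eq_matI)
    fix i j assume "i < dim_row (1\<^sub>m ?n :: complex mat)" "j < dim_col (1\<^sub>m ?n :: complex mat)"
    hence ij: "i < ?n" "j < ?n" by auto
    have "(U4\<^sup>\<dagger> * U4) $$ (i, j) = (\<Sum>r<?n. cnj (U4 $$ (r, i)) * U4 $$ (r, j))"
      using ij cU4 by (subst index_mult_mat_sum[of _ ?n ?n _ ?n]) (auto simp del: sum.lessThan_Suc)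
    also have "\<dots> = 1\<^sub>m ?n $$ (i, j)"
    proof (cases i; cases j)
      fix i' j' assume [simp]: "i = Suc i'" "j = Suc j'"
      have lt: "i' < m" "j' < m" using ij by auto
      have "(\<Sum>r<?n. cnj (U4 $$ (r, i)) * U4 $$ (r, j)) = (\<Sum>r<m. cnj (U3 $$ (r, i')) * U3 $$ (r, j'))"
        using lt by (simp add: sum.lessThan_Suc_shift U4_00 del: sum.lessThan_Suc)
      also have "\<dots> = (U3\<^sup>\<dagger> * U3) $$ (i', j')"
        using lt cU3 by (subst index_mult_mat_sum[of _ m m _ m]) auto
      finally show ?thesis using lt by (simp add: unitary_left[OF U3])
    qed (use ij in \<open>auto simp: sum.lessThan_Suc_shift U4_00 simp del: sum.lessThan_Suc\<close>)
    finally show "(U4\<^sup>\<dagger> * U4) $$ (i, j) = 1\<^sub>m ?n $$ (i, j)" .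
  qed (use cU4 in auto)
  hence U4: "unitary_mat ?n U4" using cU4 by (simp add: unitary_mat_def)
  have A'eq: "A' = spec_mat ?n U4 d"
  proof (rule eq_matI)
    fix i j assume "i < dim_row (spec_mat ?n U4 d)" "j < dim_col (spec_mat ?n U4 d)"
    hence ij: "i < ?n" "j < ?n" using cU4 by (auto simp: spec_mat_def)
    have sp: "spec_mat ?n U4 d $$ (i, j) = (\<Sum>l<?n. U4 $$ (i, l) * of_real (d l) * cnj (U4 $$ (j, l)))"
      by (rule index_spec_mat[OF cU4 ij])
    show "A' $$ (i, j) = spec_mat ?n U4 d $$ (i, j)"
    proof (cases i; cases j)
      fix i' j' assume [simp]: "i = Suc i'" "j = Suc j'"
      have lt: "i' < m" "j' < m" using ij by auto
      have "A' $$ (i, j) = A3 $$ (i', j')" using lt by (simp add: A3_def)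
      also have "\<dots> = spec_mat ?n U4 d $$ (i, j)"
        unfolding sp A3 using lt
        by (simp add: index_spec_mat[OF cU3] sum.lessThan_Suc_shift U4_00 d_simps del: sum.lessThan_Suc)
      finally show ?thesis .
    qed (use ij in \<open>auto simp: index_spec_mat[OF cU4] sum.lessThan_Suc_shift U4_00 A'0 A'0r d_simps e[symmetric] simp del: sum.lessThan_Suc\<close>)
  qed (use cU4 cA' in \<open>auto simp: spec_mat_def\<close>)
  have "A = (W * W\<^sup>\<dagger>) * (A * (W * W\<^sup>\<dagger>))"
    using A by (simp add: unitary_right[OF W])
  also have "\<dots> = W * (A' * W\<^sup>\<dagger>)"
    unfolding A'_def using A cW
    by (simp add: assoc_mult_mat[of _ ?n ?n _ ?n _ ?n] mult_carrier_mat[of _ ?n ?n _ ?n])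
  also have "\<dots> = spec_mat ?n (W * U4) d"
    unfolding A'eq spec_mat_def using cW cU4
    by (simp add: assoc_mult_mat[of _ ?n ?n _ ?n _ ?n] mult_carrier_mat[of _ ?n ?n _ ?n] adjoint_mult[of _ ?n ?n _ ?n])
  finally show ?case using unitary_mult[OF W U4] by blast
qed

lemma antimono_permutation:
  fixes d :: "nat \<Rightarrow> real"
  obtains p where "p permutes {..<n}" "\<And>i j. i \<le> j \<Longrightarrow> j < n \<Longrightarrow> d (p j) \<le> d (p i)"
proof -
  let ?xs = "map d [0..<n]"
  have "mset (rev (sort ?xs)) = mset ?xs" by simp
  then obtain p where p: "p permutes {..<length ?xs}" "permute_list p ?xs = rev (sort ?xs)"
    by (rule mset_eq_permutation)
  have nth: "rev (sort ?xs) ! i = d (p i)" if "i < n" for i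
    using that p permutes_in_image[OF p(1), of i] permute_list_nth[OF p(1), of i] by auto
  have "sorted (rev (rev (sort ?xs)))" by simp
  hence "rev (sort ?xs) ! j \<le> rev (sort ?xs) ! i" if "i \<le> j" "j < n" for i j
    using that unfolding sorted_rev_iff_nth_mono by simp
  with nth have "d (p j) \<le> d (p i)" if "i \<le> j" "j < n" for i j
    using that by (metis le_less_trans)
  with p(1) show thesis by (intro that[of p]) auto
qed

lemma spectral_decomposition_antimono:
  fixes A :: "complex mat"
  assumes A: "A \<in> carrier_mat n n" "A\<^sup>\<dagger> = A"
  obtains U d where "unitary_mat n U" "A = spec_mat n U d"
    "\<And>i j. i \<le> j \<Longrightarrow> j < n \<Longrightarrow> d j \<le> d i"
proof -
  obtain U d where U: "unitary_mat n U" and Aeq: "A = spec_mat n U d"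
    using spectral_decomposition[OF A] by blast
  note cU = unitary_carrier[OF U]
  obtain p where p: "p permutes {..<n}" and mono: "\<And>i j. i \<le> j \<Longrightarrow> j < n \<Longrightarrow> d (p j) \<le> d (p i)"
    using antimono_permutation by blast
  define V where "V = mat n n (\<lambda>(i, j). U $$ (i, p j))"
  have cV: "V \<in> carrier_mat n n" by (simp add: V_def)
  have pl: "p j < n" if "j < n" for j using that permutes_in_image[OF p, of j] by simp
  have "V\<^sup>\<dagger> * V = 1\<^sub>m n"
  proof (rule eq_matI)
    fix i j assume "i < dim_row (1\<^sub>m n :: complex mat)" "j < dim_col (1\<^sub>m n :: complex mat)"
    hence ij: "i < n" "j < n" by auto
    have "(V\<^sup>\<dagger> * V) $$ (i, j) = (U\<^sup>\<dagger> * U) $$ (p i, p j)"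
      using ij cV cU pl by (subst (1 2) index_mult_mat_sum[of _ n n _ n]) (auto simp: V_def)
    also have "\<dots> = 1\<^sub>m n $$ (i, j)"
      using ij pl by (auto simp: unitary_left[OF U] permutes_inj[OF p, THEN inj_eq])
    finally show "(V\<^sup>\<dagger> * V) $$ (i, j) = 1\<^sub>m n $$ (i, j)" .
  qed (use cV in auto)
  hence V: "unitary_mat n V" using cV by (simp add: unitary_mat_def)
  have "A = spec_mat n V (d \<circ> p)"
  proof (rule eq_matI)
    fix i j assume "i < dim_row (spec_mat n V (d \<circ> p))" "j < dim_col (spec_mat n V (d \<circ> p))"
    hence ij: "i < n" "j < n" using cV by (auto simp: spec_mat_def)
    show "A $$ (i, j) = spec_mat n V (d \<circ> p) $$ (i, j)"
      unfolding Aeq index_spec_mat[OF cU ij] index_spec_mat[OF cV ij]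
      using ij by (subst sum.permute[OF p]) (auto simp: V_def)
  qed (use cV cU Aeq in \<open>auto simp: spec_mat_def\<close>)
  with V mono show thesis by (intro that[of V "d \<circ> p"]) auto
qed

section \<open>Compressions to subspaces and Gram matrices\<close>

lemma index_gram_diag:
  fixes N :: "complex mat"
  assumes N: "N \<in> carrier_mat n k" and i: "i < k"
  shows "(N\<^sup>\<dagger> * N) $$ (i, i) = of_real (\<Sum>r<n. (cmod (N $$ (r, i)))\<^sup>2)"
proof -
  have "(N\<^sup>\<dagger> * N) $$ (i, i) = (\<Sum>r<n. N $$ (r, i) * cnj (N $$ (r, i)))"
    using N i by (subst index_mult_mat_sum[of _ k n _ k]) (auto simp: mult.commute)
  thus ?thesis by (simp only: of_real_sum complex_norm_square)
qed

lemma spec_mat_mult_right: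
  assumes U: "U \<in> carrier_mat n n" and E: "E \<in> carrier_mat n k"
  shows "E\<^sup>\<dagger> * (spec_mat n U d * E) = (U\<^sup>\<dagger> * E)\<^sup>\<dagger> * (rdiag n d * (U\<^sup>\<dagger> * E))"
  unfolding spec_mat_def using U E
  by (simp add: adjoint_mult[of _ n n _ k] assoc_mult_mat[of _ n n _ n _ n]
      assoc_mult_mat[of _ n n _ n _ k] assoc_mult_mat[of _ k n _ n _ k] mult_carrier_mat[of _ n n _ n]
      mult_carrier_mat[of _ n n _ k])

lemma unitary_gram:
  assumes U: "unitary_mat n U" and E: "E \<in> carrier_mat n k"
  shows "(U\<^sup>\<dagger> * E)\<^sup>\<dagger> * (U\<^sup>\<dagger> * E) = E\<^sup>\<dagger> * E"
proof -
  note cU = unitary_carrier[OF U]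
  have "(U\<^sup>\<dagger> * E)\<^sup>\<dagger> * (U\<^sup>\<dagger> * E) = E\<^sup>\<dagger> * ((U * U\<^sup>\<dagger>) * E)"
    using cU E by (simp add: adjoint_mult[of _ n n _ k] assoc_mult_mat[of _ n n _ n _ k]
      assoc_mult_mat[of _ k n _ n _ k] mult_carrier_mat[of _ n n _ k])
  thus ?thesis using E by (simp add: unitary_right[OF U])
qed

lemma det_spec_compression_le:
  assumes U: "unitary_mat n U" and E: "E \<in> carrier_mat n k"
    and d: "\<And>i. i < n \<Longrightarrow> 0 \<le> d i" "\<And>i j. i \<le> j \<Longrightarrow> j < n \<Longrightarrow> d j \<le> d i"
  shows "cmod (det (E\<^sup>\<dagger> * (spec_mat n U d * E))) \<le> (\<Prod>i<k. d i) * cmod (det (E\<^sup>\<dagger> * E))"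
proof -
  have "U\<^sup>\<dagger> * E \<in> carrier_mat n k" using unitary_carrier[OF U] E by (meson adjoint_carrier mult_carrier_mat)
  from det_compression_le[OF this d] show ?thesis
    by (simp add: spec_mat_mult_right[OF unitary_carrier[OF U] E] unitary_gram[OF U E])
qed

text \<open>The first \<open>k\<close> columns of \<open>U\<close>. As test matrices they turn a
  bound on compressed determinants into a bound on the product of the first \<open>k\<close>
  eigenvalues.\<close>

lemma spec_eigen_columns:
  assumes U: "unitary_mat n U" and k: "k \<le> n"
  obtains E where "E \<in> carrier_mat n k" "E\<^sup>\<dagger> * E = 1\<^sub>m k" "spec_mat n U d * E = E * rdiag k d"
proof
  note cU = unitary_carrier[OF U]
  let ?E = "mat n k (\<lambda>(i, j). U $$ (i, j))"
  show cE: "?E \<in> carrier_mat n k" by simp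
  show "?E\<^sup>\<dagger> * ?E = 1\<^sub>m k"
  proof (rule eq_matI)
    fix i j assume "i < dim_row (1\<^sub>m k :: complex mat)" "j < dim_col (1\<^sub>m k :: complex mat)"
    hence ij: "i < k" "j < k" by auto
    have "(?E\<^sup>\<dagger> * ?E) $$ (i, j) = (\<Sum>r<n. cnj (U $$ (r, i)) * U $$ (r, j))"
      using ij k by (subst index_mult_mat_sum[of _ k n _ k]) auto
    also have "\<dots> = (U\<^sup>\<dagger> * U) $$ (i, j)"
      using ij k cU by (subst index_mult_mat_sum[of _ n n _ n]) auto
    finally show "(?E\<^sup>\<dagger> * ?E) $$ (i, j) = 1\<^sub>m k $$ (i, j)"
      using ij k by (simp add: unitary_left[OF U])
  qed auto
  have eig: "spec_mat n U d * U = U * rdiag n d"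
    unfolding spec_mat_def using cU
    by (simp add: assoc_mult_mat[of _ n n _ n _ n] mult_carrier_mat[of _ n n _ n] unitary_left[OF U])
  show "spec_mat n U d * ?E = ?E * rdiag k d"
  proof (rule eq_matI)
    fix i j assume "i < dim_row (?E * rdiag k d)" "j < dim_col (?E * rdiag k d)"
    hence ij: "i < n" "j < k" by auto
    have "(spec_mat n U d * ?E) $$ (i, j) = (\<Sum>r<n. spec_mat n U d $$ (i, r) * U $$ (r, j))"
      using ij cU cE by (subst index_mult_mat_sum[of _ n n _ k]) auto
    also have "\<dots> = (spec_mat n U d * U) $$ (i, j)"
      using ij k cU by (subst index_mult_mat_sum[of _ n n _ n]) auto
    also have "\<dots> = (?E * rdiag k d) $$ (i, j)"
      unfolding eig using ij k cU by (simp add: index_mult_rdiag[of _ n n] index_mult_rdiag[of _ n k] del: index_mult_mat(1))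
    finally show "(spec_mat n U d * ?E) $$ (i, j) = (?E * rdiag k d) $$ (i, j)" .
  qed (use cU in auto)
qed

text \<open>Nonnegativity comes from \<open>x i\<close> being the squared norm of column
  \<open>i\<close> of \<open>M * H\<close>.\<close>

lemma gram_spectral_decomposition:
  assumes M: "(M :: complex mat) \<in> carrier_mat n n"
  obtains H x where "unitary_mat n H" "M\<^sup>\<dagger> * M = spec_mat n H x"
    "\<And>i. i < n \<Longrightarrow> 0 \<le> x i" "\<And>i j. i \<le> j \<Longrightarrow> j < n \<Longrightarrow> x j \<le> x i"
proof -
  have MM: "M\<^sup>\<dagger> * M \<in> carrier_mat n n" "(M\<^sup>\<dagger> * M)\<^sup>\<dagger> = M\<^sup>\<dagger> * M"
    using M by (auto simp: adjoint_mult[of _ n n _ n])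
  obtain H x where H: "unitary_mat n H" and eq: "M\<^sup>\<dagger> * M = spec_mat n H x"
    and mono: "\<And>i j. i \<le> j \<Longrightarrow> j < n \<Longrightarrow> x j \<le> x i"
    using spectral_decomposition_antimono[OF MM] by blast
  note cH = unitary_carrier[OF H]
  have "0 \<le> x i" if i: "i < n" for i
  proof -
    have cMH: "M * H \<in> carrier_mat n n" using M cH by auto
    have "(M * H)\<^sup>\<dagger> * (M * H) = H\<^sup>\<dagger> * (spec_mat n H x * H)"
      unfolding eq[symmetric] using M cH
      by (simp add: adjoint_mult[of _ n n _ n] assoc_mult_mat[of _ n n _ n _ n] mult_carrier_mat[of _ n n _ n])
    also have "\<dots> = rdiag n x"
      unfolding spec_mat_mult_right[OF cH cH] by (simp add: unitary_left[OF H])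
    finally have "of_real (x i) = ((M * H)\<^sup>\<dagger> * (M * H)) $$ (i, i)" using i by simp
    also have "\<dots> = of_real (\<Sum>r<n. (cmod ((M * H) $$ (r, i)))\<^sup>2)"
      by (rule index_gram_diag[OF cMH i])
    finally have "x i = (\<Sum>r<n. (cmod ((M * H) $$ (r, i)))\<^sup>2)" by (simp only: of_real_eq_iff)
    thus ?thesis by (simp add: sum_nonneg)
  qed
  with H eq mono show thesis by (intro that[of H x]) auto
qed

section \<open>Continuity in a real parameter and closed midpoint-convex sets\<close>

lemma continuous_on_det:
  fixes M :: "real \<Rightarrow> complex mat"
  assumes "\<And>t. M t \<in> carrier_mat k k"
    and "\<And>i j. i < k \<Longrightarrow> j < k \<Longrightarrow> continuous_on UNIV (\<lambda>t. M t $$ (i, j))"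
  shows "continuous_on UNIV (\<lambda>t. det (M t))"
  unfolding det_def'[OF assms(1)]
  by (intro continuous_intros assms(2)) (auto dest: permutes_in_image)

lemma continuous_on_mat_mult:
  fixes M N :: "real \<Rightarrow> complex mat"
  assumes "\<And>t. M t \<in> carrier_mat m k" "\<And>t. N t \<in> carrier_mat k l"
    and "\<And>i j. i < m \<Longrightarrow> j < k \<Longrightarrow> continuous_on UNIV (\<lambda>t. M t $$ (i, j))"
    and "\<And>i j. i < k \<Longrightarrow> j < l \<Longrightarrow> continuous_on UNIV (\<lambda>t. N t $$ (i, j))"
    and "i < m" "j < l"
  shows "continuous_on UNIV (\<lambda>t. (M t * N t) $$ (i, j))"
  unfolding index_mult_mat_sum[OF assms(1,2,5,6)]
  by (intro continuous_intros assms(3,4)) (use assms(5,6) in auto)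

lemma continuous_on_spec_mat:
  assumes "U \<in> carrier_mat n n"
    and "\<And>l. l < n \<Longrightarrow> continuous_on UNIV (\<lambda>t :: real. d t l)"
    and "i < n" "j < n"
  shows "continuous_on UNIV (\<lambda>t. spec_mat n U (d t) $$ (i, j))"
  unfolding index_spec_mat[OF assms(1,3,4)]
  by (intro continuous_intros assms(2)) auto

text \<open>Let \<open>l\<close> and \<open>u\<close> be the points of \<open>K\<close> nearest to
  \<open>t\<close> on either side. Their midpoint lies in \<open>K\<close>, and if \<open>t\<close>
  were strictly between them it would be nearer to \<open>t\<close> on one of the sides.\<close>

lemma midpoint_closed_unit_interval:
  fixes K :: "real set"
  assumes K: "closed K" "0 \<in> K" "1 \<in> K"
    and mid: "\<And>s t. s \<in> K \<Longrightarrow> t \<in> K \<Longrightarrow> (s + t) / 2 \<in> K"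
    and t: "0 \<le> t" "t \<le> 1"
  shows "t \<in> K"
proof -
  have ne: "K \<inter> {0..t} \<noteq> {}" "K \<inter> {t..1} \<noteq> {}" using K t by auto
  have bdd: "bdd_above (K \<inter> {0..t})" "bdd_below (K \<inter> {t..1})"
    by (meson IntE atLeastAtMost_iff bdd_aboveI bdd_belowI)+
  define l where "l = Sup (K \<inter> {0..t})"
  define u where "u = Inf (K \<inter> {t..1})"
  have l: "l \<in> K \<inter> {0..t}"
    unfolding l_def using ne bdd K by (intro closed_contains_Sup closed_Int) auto
  have u: "u \<in> K \<inter> {t..1}"
    unfolding u_def using ne bdd K by (intro closed_contains_Inf closed_Int) auto
  have m: "(l + u) / 2 \<in> K" using mid l u by auto
  show ?thesis
  proof (cases "(l + u) / 2 \<le> t")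
    case True
    hence "(l + u) / 2 \<in> K \<inter> {0..t}" using l u m t by auto
    hence "(l + u) / 2 \<le> l" unfolding l_def using bdd by (intro cSup_upper) auto
    with l u have "l = t" by auto
    with l show ?thesis by auto
  next
    case False
    hence "(l + u) / 2 \<in> K \<inter> {t..1}" using l u m t by auto
    hence "u \<le> (l + u) / 2" unfolding u_def using bdd by (intro cInf_lower) auto
    with l u have "u = t" by auto
    with u show ?thesis by auto
  qed
qed

subsection \<open>Dominated functions\<close>

text \<open>Eigendata of \<open>A\<close>, \<open>B\<close> and \<open>C\<close> in this order. The
  assumption \<open>product\<close> is the defining relation of \<open>C\<close> in squared form:
  \<open>sqrt A * B * sqrt A\<close> equals the square of \<open>C\<close>.\<close>

locale spectral_pair =
  fixes n :: nat and U V W :: "complex mat" and a b c :: "nat \<Rightarrow> real"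
  assumes U: "unitary_mat n U" and V: "unitary_mat n V" and W: "unitary_mat n W"
    and a: "\<And>i. i < n \<Longrightarrow> 0 \<le> a i" and b: "\<And>i. i < n \<Longrightarrow> 0 \<le> b i" and c: "\<And>i. i < n \<Longrightarrow> 0 \<le> c i"
    and c_antimono: "\<And>i j. i \<le> j \<Longrightarrow> j < n \<Longrightarrow> c j \<le> c i"
    and product: "spec_mat n U (\<lambda>i. sqrt (a i)) * (spec_mat n V b * spec_mat n U (\<lambda>i. sqrt (a i))) =
      spec_mat n W (\<lambda>i. (c i)\<^sup>2)"
begin

definition FA :: "(real \<Rightarrow> real) \<Rightarrow> complex mat" where
  "FA f = spec_mat n U (\<lambda>i. f (a i))"

definition FB :: "(real \<Rightarrow> real) \<Rightarrow> complex mat" where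
  "FB f = spec_mat n V (\<lambda>i. f (b i))"

text \<open>For \<open>f\<close> nonnegative on the nonnegative reals this is a positive
  semidefinite substitute for \<open>FA f * FB f\<close> with the same trace.\<close>

definition T :: "(real \<Rightarrow> real) \<Rightarrow> complex mat" where
  "T f = FA (\<lambda>x. sqrt (f x)) * (FB f * FA (\<lambda>x. sqrt (f x)))"

text \<open>Weak log-majorization of the eigenvalues of \<open>T f\<close> by \<open>(f (c j))\<^sup>2\<close>, phrased with determinants
  instead of ordered eigenvalues so that it is visibly preserved under pointwise limits of \<open>f\<close>.\<close>

definition dominated :: "(real \<Rightarrow> real) \<Rightarrow> bool" where
  "dominated f \<longleftrightarrow> (\<forall>k\<le>n. \<forall>E\<in>carrier_mat n k.
     cmod (det (E\<^sup>\<dagger> * (T f * E))) \<le> (\<Prod>j<k. (f (c j))\<^sup>2) * cmod (det (E\<^sup>\<dagger> * E)))"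

lemma cU: "U \<in> carrier_mat n n" and cV: "V \<in> carrier_mat n n" and cW: "W \<in> carrier_mat n n"
  using U V W by (simp_all add: unitary_carrier)

lemma FA_carrier [simp, intro]: "FA f \<in> carrier_mat n n" and FB_carrier [simp, intro]: "FB f \<in> carrier_mat n n"
  by (simp_all add: FA_def FB_def cU cV)

lemma T_carrier [simp, intro]: "T f \<in> carrier_mat n n"
  unfolding T_def by (auto intro!: mult_carrier_mat[of _ n n _ n])

lemma FA_adjoint [simp]: "(FA f)\<^sup>\<dagger> = FA f" and FB_adjoint [simp]: "(FB f)\<^sup>\<dagger> = FB f"
  by (simp_all add: FA_def FB_def cU cV spec_mat_adjoint)

lemma FA_mult: "FA f * FA g = FA (\<lambda>x. f x * g x)" and FB_mult: "FB f * FB g = FB (\<lambda>x. f x * g x)"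
  by (simp_all add: FA_def FB_def U V spec_mat_mult)

lemma FA_cong: "(\<And>x. 0 \<le> x \<Longrightarrow> f x = g x) \<Longrightarrow> FA f = FA g"
  unfolding FA_def by (rule spec_mat_cong[OF cU]) (use a in auto)

lemma FB_cong: "(\<And>x. 0 \<le> x \<Longrightarrow> f x = g x) \<Longrightarrow> FB f = FB g"
  unfolding FB_def by (rule spec_mat_cong[OF cV]) (use b in auto)

text \<open>Domination sees \<open>f\<close> only at finitely many points: \<open>T f\<close> at the
  entries of \<open>a\<close> and \<open>b\<close>, the bound at those of \<open>c\<close>. Hence it
  suffices to interpolate \<open>f\<close> on this finite set.\<close>

lemma dominated_cong_spectrum:
  assumes "\<And>x. x \<in> a ` {..<n} \<union> b ` {..<n} \<union> c ` {..<n} \<Longrightarrow> f x = g x" "dominated f"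
  shows "dominated g"
proof -
  have "FA (\<lambda>x. sqrt (f x)) = FA (\<lambda>x. sqrt (g x))"
    unfolding FA_def by (rule spec_mat_cong[OF cU]) (use assms in auto)
  moreover have "FB f = FB g"
    unfolding FB_def by (rule spec_mat_cong[OF cV]) (use assms in auto)
  ultimately have "T f = T g" by (simp add: T_def)
  moreover have "(\<Prod>j<k. (f (c j))\<^sup>2) = (\<Prod>j<k. (g (c j))\<^sup>2)" if "k \<le> n" for k
    using that assms by (intro prod.cong) auto
  ultimately show ?thesis using assms(2) unfolding dominated_def by simp
qed

lemma dominated_cong:
  "(\<And>x. 0 \<le> x \<Longrightarrow> f x = g x) \<Longrightarrow> dominated f \<Longrightarrow> dominated g"
  by (rule dominated_cong_spectrum[of f g]) (use a b c in auto)

lemma T_spectral: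
  assumes f: "\<And>x. 0 \<le> x \<Longrightarrow> 0 \<le> f x"
  obtains H x where "unitary_mat n H" "T f = spec_mat n H x"
    "\<And>i. i < n \<Longrightarrow> 0 \<le> x i" "\<And>i j. i \<le> j \<Longrightarrow> j < n \<Longrightarrow> x j \<le> x i"
proof -
  let ?M = "FB (\<lambda>x. sqrt (f x)) * FA (\<lambda>x. sqrt (f x))"
  have M: "?M \<in> carrier_mat n n" by (auto intro!: mult_carrier_mat[of _ n n _ n])
  have sq: "FB f = FB (\<lambda>x. sqrt (f x)) * FB (\<lambda>x. sqrt (f x))"
    unfolding FB_mult by (rule FB_cong) (use f in auto)
  have "T f = ?M\<^sup>\<dagger> * ?M"
    unfolding T_def sq
    by (simp add: adjoint_mult[of _ n n _ n] assoc_mult_mat[of _ n n _ n _ n] mult_carrier_mat[of _ n n _ n])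
  with gram_spectral_decomposition[OF M] show thesis using that by metis
qed

text \<open>Up to a similarity, \<open>T (sqrt (p q))\<close> is the product of \<open>FA (sqrt p) * FB (sqrt p)\<close> and
  \<open>FB (sqrt q) * FA (sqrt q)\<close>, whose Gram matrices are \<open>T p\<close> and \<open>T q\<close>. Restricting to the span \<open>Z\<close>
  of the leading eigenvectors and applying the Cauchy-Schwarz inequality for Gram determinants
  bounds the product of the leading eigenvalues.\<close>

lemma dominated_sqrt_mult:
  assumes dom: "dominated p" "dominated q"
    and pos: "\<And>x. 0 \<le> x \<Longrightarrow> 0 \<le> p x" "\<And>x. 0 \<le> x \<Longrightarrow> 0 \<le> q x"
  shows "dominated (\<lambda>x. sqrt (p x * q x))"
proof -
  define w where "w = (\<lambda>x. sqrt (p x * q x))"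
  have w: "0 \<le> w x" if "0 \<le> x" for x using that pos by (simp add: w_def)
  obtain H x where H: "unitary_mat n H" and TH: "T w = spec_mat n H x"
    and x0: "\<And>i. i < n \<Longrightarrow> 0 \<le> x i" and xm: "\<And>i j. i \<le> j \<Longrightarrow> j < n \<Longrightarrow> x j \<le> x i"
    using T_spectral[of w] w by metis
  have key: "(\<Prod>j<k. x j) \<le> (\<Prod>j<k. (w (c j))\<^sup>2)" if k: "k \<le> n" for k
  \<comment> \<open>A vanishing leading product makes the bound trivial. Otherwise the diagonal
    matrix \<open>?L\<close> of leading eigenvalues is invertible, which later shows that
    \<open>Z\<close> has full rank.\<close>
  proof (cases "\<exists>j<k. x j = 0")
    case True
    hence "(\<Prod>j<k. x j) = 0" by (intro prod_zero) auto
    moreover have "0 \<le> (\<Prod>j<k. (w (c j))\<^sup>2)" by (intro prod_nonneg) auto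
    ultimately show ?thesis by linarith
  next
    case False
    hence xpos: "0 < (\<Prod>j<k. x j)" using x0 k by (intro prod_pos) (auto simp: order_less_le)
    let ?L = "rdiag k x"
    obtain E where E: "E \<in> carrier_mat n k" and EE: "E\<^sup>\<dagger> * E = 1\<^sub>m k" and TE: "T w * E = E * ?L"
      unfolding TH using spec_eigen_columns[OF H k] by metis
    define Aw where "Aw = FA (\<lambda>x. sqrt (w x))"
    define Ap where "Ap = FA (\<lambda>x. sqrt (p x))"
    define Aq where "Aq = FA (\<lambda>x. sqrt (q x))"
    define Bp where "Bp = FB (\<lambda>x. sqrt (p x))"
    define Bq where "Bq = FB (\<lambda>x. sqrt (q x))"
    have car [simp]: "Aw \<in> carrier_mat n n" "Ap \<in> carrier_mat n n" "Aq \<in> carrier_mat n n"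
      "Bp \<in> carrier_mat n n" "Bq \<in> carrier_mat n n"
      by (auto simp: Aw_def Ap_def Aq_def Bp_def Bq_def)
    have adj [simp]: "Aw\<^sup>\<dagger> = Aw" "Ap\<^sup>\<dagger> = Ap" "Aq\<^sup>\<dagger> = Aq" "Bp\<^sup>\<dagger> = Bp" "Bq\<^sup>\<dagger> = Bq"
      by (auto simp: Aw_def Ap_def Aq_def Bp_def Bq_def)
    note ac = assoc_mult_mat[of _ n n _ n _ n] assoc_mult_mat[of _ n n _ n _ k] assoc_mult_mat[of _ n n _ k _ k]
      assoc_mult_mat[of _ k n _ n _ n] assoc_mult_mat[of _ k n _ n _ k] assoc_mult_mat[of _ k n _ k _ k]
      assoc_mult_mat[of _ k k _ k _ k] assoc_mult_mat[of _ n k _ k _ k]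
    note mc = mult_carrier_mat[of _ n n _ n] mult_carrier_mat[of _ n n _ k] mult_carrier_mat[of _ n k _ k]
      mult_carrier_mat[of _ k n _ n] mult_carrier_mat[of _ k n _ k] mult_carrier_mat[of _ k k _ k]
    have fold: "M * (N * Y) = (M * N) * Y"
      if "M \<in> carrier_mat n n" "N \<in> carrier_mat n n" "Y \<in> carrier_mat n k" for M N Y :: "complex mat"
      using that by (simp add: ac)
    have AwAw: "Aw * Aw = FA w"
      unfolding Aw_def FA_mult by (rule FA_cong) (use w in auto)
    have AqAp: "Aq * Ap = FA w"
      unfolding Aq_def Ap_def FA_mult by (rule FA_cong) (simp add: w_def real_sqrt_mult mult.commute)
    have BpBq: "Bp * Bq = FB w"
      unfolding Bq_def Bp_def FB_mult by (rule FB_cong) (simp add: w_def real_sqrt_mult)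
    have BpBp: "Bp * Bp = FB p" and BqBq: "Bq * Bq = FB q"
      unfolding Bq_def Bp_def FB_mult by (rule FB_cong; use pos in auto)+
    have Tw: "Aw * (FB w * (Aw * E)) = E * ?L"
      using TE E unfolding T_def Aw_def[symmetric] by (simp add: ac mc)
    \<comment> \<open>\<open>Tw\<close> reads \<open>Aw * X = E * ?L\<close>, so the columns of
      \<open>X\<close> span an invariant subspace of \<open>FB w * FA w\<close>, on which it acts as
      \<open>?L\<close> (this is \<open>BAX\<close>). Since \<open>FA w = Aq * Ap\<close>, the
      matrix \<open>Z = Ap * X\<close> then satisfies \<open>Ap * FB w * Aq * Z = Z * ?L\<close>.
      Splitting \<open>FB w = Bp * Bq\<close> displays this operator as a product of one factor
      belonging to \<open>p\<close> and one belonging to \<open>q\<close>.\<close>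
    define X where "X = FB w * (Aw * E)"
    define Z where "Z = Ap * X"
    have X: "X \<in> carrier_mat n k" using E by (simp add: X_def mc)
    have Z: "Z \<in> carrier_mat n k" using X by (simp add: Z_def mc)
    have AqZ: "Aq * Z = FA w * X" unfolding Z_def using X by (simp add: fold AqAp)
    have BAX: "FB w * (FA w * X) = X * ?L"
    proof -
      have "FA w * X = Aw * (Aw * X)" using X by (simp add: fold AwAw)
      also have "Aw * X = E * ?L" unfolding X_def by (rule Tw)
      finally show ?thesis unfolding X_def using E by (simp add: ac mc)
    qed
    define P where "P = Bp * (Ap * Z)"
    define Q where "Q = Bq * (Aq * Z)"
    have P: "P \<in> carrier_mat n k" and Q: "Q \<in> carrier_mat n k"
      using Z by (auto simp: P_def Q_def mc)
    have P': "P\<^sup>\<dagger> = Z\<^sup>\<dagger> * (Ap * Bp)" and Q': "Q\<^sup>\<dagger> = Z\<^sup>\<dagger> * (Aq * Bq)"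
      unfolding P_def Q_def using Z by (simp_all add: adjoint_mult[of _ n n _ k] ac mc)
    have PQ: "P\<^sup>\<dagger> * Q = (Z\<^sup>\<dagger> * Z) * ?L"
    proof -
      have "P\<^sup>\<dagger> * Q = Z\<^sup>\<dagger> * (Ap * (Bp * (Bq * (Aq * Z))))"
        unfolding P' Q_def using Z by (simp add: ac mc)
      also have "Bp * (Bq * (Aq * Z)) = FB w * (FA w * X)"
        using Z X by (simp add: fold[of Bp Bq] BpBq mc AqZ)
      also have "Ap * (FB w * (FA w * X)) = Z * ?L"
        unfolding BAX Z_def using X by (simp add: ac mc)
      finally show ?thesis using Z by (simp add: ac)
    qed
    have PP: "P\<^sup>\<dagger> * P = Z\<^sup>\<dagger> * (T p * Z)"
    proof -
      have "P\<^sup>\<dagger> * P = Z\<^sup>\<dagger> * (Ap * (Bp * (Bp * (Ap * Z))))"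
        unfolding P' unfolding P_def using Z by (simp add: ac mc)
      also have "Bp * (Bp * (Ap * Z)) = FB p * (Ap * Z)"
        using Z by (simp add: fold[of Bp Bp] BpBp mc)
      finally show ?thesis unfolding T_def Ap_def[symmetric] using Z by (simp add: ac mc)
    qed
    have QQ: "Q\<^sup>\<dagger> * Q = Z\<^sup>\<dagger> * (T q * Z)"
    proof -
      have "Q\<^sup>\<dagger> * Q = Z\<^sup>\<dagger> * (Aq * (Bq * (Bq * (Aq * Z))))"
        unfolding Q' unfolding Q_def using Z by (simp add: ac mc)
      also have "Bq * (Bq * (Aq * Z)) = FB q * (Aq * Z)"
        using Z by (simp add: fold[of Bq Bq] BqBq mc)
      finally show ?thesis unfolding T_def Aq_def[symmetric] using Z by (simp add: ac mc)
    qed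
    have detL: "det ?L = of_real (\<Prod>j<k. x j)" by (simp add: det_rdiag)
    define g where "g = cmod (det (Z\<^sup>\<dagger> * Z))"
    \<comment> \<open>The Gram determinant of \<open>Z\<close> has to be cancelled at the end. If it
      were zero, Cauchy-Schwarz would annihilate the determinant of the product of the adjoint of
      \<open>R\<close> with \<open>Z\<close>, for every \<open>R\<close>; the \<open>R\<close> below
      makes this product \<open>?L * ?L\<close>, which is invertible.\<close>
    have "g \<noteq> 0"
    proof
      assume g0: "g = 0"
      define R where "R = Aq * (FB w * (Aw * E))"
      have R: "R \<in> carrier_mat n k" using E by (simp add: R_def mc)
      have R': "R\<^sup>\<dagger> = E\<^sup>\<dagger> * (Aw * (FB w * Aq))"
        unfolding R_def using E by (simp add: adjoint_mult[of _ n n _ k] ac mc)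
      have "R\<^sup>\<dagger> * Z = E\<^sup>\<dagger> * (Aw * (FB w * (Aq * Z)))"
        unfolding R' using E Z by (simp add: ac mc)
      also have "Aw * (FB w * (Aq * Z)) = (Aw * X) * ?L"
        unfolding AqZ BAX using X by (simp add: ac mc)
      also have "Aw * X = E * ?L" unfolding X_def by (rule Tw)
      finally have "R\<^sup>\<dagger> * Z = (E\<^sup>\<dagger> * E) * (?L * ?L)" using E by (simp add: ac mc)
      hence "R\<^sup>\<dagger> * Z = ?L * ?L" using EE by (simp add: left_mult_one_mat[of _ k k] mult_carrier_mat[of _ k k _ k])
      hence "det (R\<^sup>\<dagger> * Z) = det ?L * det ?L" by (simp add: det_mult[of _ k])
      moreover have "det ?L \<noteq> 0" unfolding detL using xpos by (metis less_irrefl of_real_eq_0_iff)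
      ultimately have "det (R\<^sup>\<dagger> * Z) \<noteq> 0" by simp
      moreover have "(cmod (det (R\<^sup>\<dagger> * Z)))\<^sup>2 \<le> 0"
        using det_Cauchy_Schwarz[OF R Z] g0 by (simp add: g_def)
      ultimately show False by simp
    qed
    hence g: "0 < g" by (simp add: g_def)
    \<comment> \<open>By \<open>PQ\<close> the mixed determinant is the leading product times
      \<open>g\<close>, while the two Gram determinants are compressions of \<open>T p\<close> and
      \<open>T q\<close> by the same \<open>Z\<close>. As \<open>w^2 = p * q\<close>, the resulting
      bound is again a perfect square.\<close>
    have "((\<Prod>j<k. x j) * g)\<^sup>2 = (cmod (det (P\<^sup>\<dagger> * Q)))\<^sup>2"
      unfolding PQ g_def using Z xpos
      by (simp add: det_mult[of _ k] detL norm_mult mc mult.commute del: of_real_prod)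
    also have "\<dots> \<le> cmod (det (P\<^sup>\<dagger> * P)) * cmod (det (Q\<^sup>\<dagger> * Q))"
      by (rule det_Cauchy_Schwarz[OF P Q])
    also have "\<dots> \<le> ((\<Prod>j<k. (p (c j))\<^sup>2) * g) * ((\<Prod>j<k. (q (c j))\<^sup>2) * g)"
      unfolding PP QQ g_def using dom k Z
      by (intro mult_mono) (auto simp: dominated_def prod_nonneg)
    also have "\<dots> = ((\<Prod>j<k. (w (c j))\<^sup>2) * g)\<^sup>2"
    proof -
      have "(\<Prod>j<k. (p (c j))\<^sup>2) * (\<Prod>j<k. (q (c j))\<^sup>2) = (\<Prod>j<k. (w (c j))\<^sup>2)\<^sup>2"
        unfolding prod_power_distrib prod.distrib[symmetric]
        by (intro prod.cong refl) (use c k pos in \<open>auto simp: w_def power2_eq_square\<close>)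
      thus ?thesis by (simp add: power2_eq_square mult_ac)
    qed
    finally have "(\<Prod>j<k. x j) * g \<le> (\<Prod>j<k. (w (c j))\<^sup>2) * g"
      by (rule power2_le_imp_le) (use g in \<open>auto intro!: mult_nonneg_nonneg prod_nonneg\<close>)
    thus ?thesis using g by simp
  qed
  \<comment> \<open>Eigenvector columns are extremal among test matrices, so the bound on leading
    products extends to every \<open>E\<close>.\<close>
  have "cmod (det (E\<^sup>\<dagger> * (T w * E))) \<le> (\<Prod>j<k. (w (c j))\<^sup>2) * cmod (det (E\<^sup>\<dagger> * E))"
    if "k \<le> n" "E \<in> carrier_mat n k" for k E
    unfolding TH using det_spec_compression_le[OF H that(2) x0 xm] key[OF that(1)]
    by (meson mult_right_mono norm_ge_zero order_trans)
  thus ?thesis unfolding dominated_def w_def by blast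
qed

text \<open>The exponents for which domination holds contain 0 and 1, are closed under midpoints by
  \<open>dominated_sqrt_mult\<close>, and form a closed set because, for fixed \<open>k\<close> and
  \<open>E\<close>, both sides depend continuously on the exponent.\<close>

lemma dominated_powr_mult:
  assumes dom: "dominated p" "dominated q"
    and pos: "\<And>x. 0 \<le> x \<Longrightarrow> 0 \<le> p x" "\<And>x. 0 \<le> x \<Longrightarrow> 0 \<le> q x"
    and zero: "\<And>x. 0 \<le> x \<Longrightarrow> p x = 0 \<longleftrightarrow> q x = 0"
    and t: "0 \<le> t" "t \<le> 1"
  shows "dominated (\<lambda>x. p x powr (1 - t) * q x powr t)"
proof -
  define f where "f = (\<lambda>t x. p x powr (1 - t) * q x powr t)"
  define K where "K = {t. dominated (f t)}"
  \<comment> \<open>Here \<open>0 powr 0 = 0\<close>. Since \<open>p\<close> and \<open>q\<close>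
    have the same zeros, \<open>f t x\<close> is constantly 0 in \<open>t\<close> at such points, so
    continuity persists there, and the endpoints give back \<open>p\<close> and \<open>q\<close>
    exactly.\<close>
  have f0: "f t x = 0" if "0 \<le> x" "p x = 0" for t x using that by (simp add: f_def)
  have cont: "continuous_on UNIV (\<lambda>t. f t x)" if x: "0 \<le> x" for x
  proof (cases "p x = 0")
    case True
    thus ?thesis using f0[OF x] by simp
  next
    case False
    with zero[OF x] show ?thesis unfolding f_def by (intro continuous_intros) auto
  qed
  have contT: "continuous_on UNIV (\<lambda>t. T (f t) $$ (i, j))" if "i < n" "j < n" for i j
    unfolding T_def FA_def FB_def using that
    by (intro continuous_on_mat_mult[of _ n n _ n] continuous_on_spec_mat continuous_on_real_sqrt)
       (auto intro: mult_carrier_mat[of _ n n _ n] cont a b cU cV)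
  have "closed K"
  proof -
    have "closed {t. cmod (det (E\<^sup>\<dagger> * (T (f t) * E))) \<le> (\<Prod>j<k. (f t (c j))\<^sup>2) * cmod (det (E\<^sup>\<dagger> * E))}"
      if k: "k \<le> n" and E: "E \<in> carrier_mat n k" for k E
    proof (intro closed_Collect_le)
      show "continuous_on UNIV (\<lambda>t. cmod (det (E\<^sup>\<dagger> * (T (f t) * E))))"
        using E
        by (intro continuous_on_norm continuous_on_det[of _ k] continuous_on_mat_mult[of _ k n _ k]
            continuous_on_mat_mult[of _ n n _ k] contT)
           (auto intro: mult_carrier_mat[of _ n n _ k] mult_carrier_mat[of _ k n _ k])
      show "continuous_on UNIV (\<lambda>t. (\<Prod>j<k. (f t (c j))\<^sup>2) * cmod (det (E\<^sup>\<dagger> * E)))"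
        using k by (intro continuous_intros cont c) auto
    qed
    moreover have "K = (\<Inter>k\<in>{..n}. \<Inter>E\<in>carrier_mat n k.
        {t. cmod (det (E\<^sup>\<dagger> * (T (f t) * E))) \<le> (\<Prod>j<k. (f t (c j))\<^sup>2) * cmod (det (E\<^sup>\<dagger> * E))})"
      by (auto simp: K_def dominated_def)
    ultimately show ?thesis by (auto intro!: closed_INT)
  qed
  moreover have "0 \<in> K" unfolding K_def mem_Collect_eq
    by (rule dominated_cong[OF _ dom(1)]) (use zero pos in \<open>auto simp: f_def\<close>)
  moreover have "1 \<in> K" unfolding K_def mem_Collect_eq
    by (rule dominated_cong[OF _ dom(2)]) (use zero pos in \<open>auto simp: f_def\<close>)
  moreover have "(s + t) / 2 \<in> K" if "s \<in> K" "t \<in> K" for s t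
  proof -
    have "dominated (\<lambda>x. sqrt (f s x * f t x))"
      using that by (intro dominated_sqrt_mult) (simp_all add: K_def, simp_all add: f_def)
    moreover have "sqrt (f s x * f t x) = f ((s + t) / 2) x" if x: "0 \<le> x" for x
    proof -
      have "f s x * f t x = (f ((s + t) / 2) x)\<^sup>2"
      proof -
        let ?m = "(s + t) / 2"
        have "f s x * f t x = p x powr ((1 - s) + (1 - t)) * q x powr (s + t)"
          by (simp only: f_def powr_add mult_ac)
        also have "\<dots> = p x powr ((1 - ?m) + (1 - ?m)) * q x powr (?m + ?m)"
          by (rule arg_cong2[where f = "\<lambda>u v. p x powr u * q x powr v"]) argo+
        also have "\<dots> = (f ?m x)\<^sup>2"
          by (simp only: f_def powr_add power2_eq_square mult_ac)
        finally show ?thesis .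
      qed
      moreover have "0 \<le> f ((s + t) / 2) x" by (simp add: f_def)
      ultimately show ?thesis by simp
    qed
    ultimately show ?thesis unfolding K_def mem_Collect_eq by (rule dominated_cong[rotated])
  qed
  ultimately have "t \<in> K" using t by (rule midpoint_closed_unit_interval)
  thus ?thesis by (simp add: K_def f_def)
qed

end

text \<open>Vectors are \<open>n \<times> 1\<close> matrices here, so that the matrix calculus applies to them.\<close>

definition qform :: "complex mat \<Rightarrow> complex mat \<Rightarrow> real" where
  "qform M v = Re ((v\<^sup>\<dagger> * (M * v)) $$ (0, 0))"

definition sqnorm :: "complex mat \<Rightarrow> real" where
  "sqnorm v = Re ((v\<^sup>\<dagger> * v) $$ (0, 0))"

lemma sqnorm_eq:
  assumes "v \<in> carrier_mat n 1"
  shows "sqnorm v = (\<Sum>l<n. (cmod (v $$ (l, 0)))\<^sup>2)"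
  unfolding sqnorm_def by (subst index_gram_diag[OF assms]) auto

lemma qform_spec:
  assumes U: "U \<in> carrier_mat n n" and v: "v \<in> carrier_mat n 1"
  shows "qform (spec_mat n U d) v = (\<Sum>l<n. d l * (cmod ((U\<^sup>\<dagger> * v) $$ (l, 0)))\<^sup>2)"
proof -
  define y where "y = U\<^sup>\<dagger> * v"
  have y: "y \<in> carrier_mat n 1" using U v by (auto simp: y_def intro!: mult_carrier_mat[of _ n n _ 1])
  have "(y\<^sup>\<dagger> * (rdiag n d * y)) $$ (0, 0) = (\<Sum>l<n. of_real (d l) * (y $$ (l, 0) * cnj (y $$ (l, 0))))"
    using y by (subst index_mult_mat_sum[of _ 1 n _ 1])
      (auto intro!: sum.cong mult_carrier_mat[of _ n n _ 1] simp: index_rdiag_mult[of _ n 1] mult_ac simp del: index_mult_mat(1))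
  also have "\<dots> = of_real (\<Sum>l<n. d l * (cmod (y $$ (l, 0)))\<^sup>2)"
    by (simp only: of_real_sum of_real_mult complex_norm_square)
  finally show ?thesis
    unfolding qform_def spec_mat_mult_right[OF U v] y_def[symmetric] by simp
qed

lemma sqnorm_unitary:
  assumes "unitary_mat n U" "v \<in> carrier_mat n 1"
  shows "sqnorm (U\<^sup>\<dagger> * v) = sqnorm v"
  unfolding sqnorm_def by (simp add: unitary_gram[OF assms])

lemma qform_spec_le:
  assumes U: "unitary_mat n U" and v: "v \<in> carrier_mat n 1" and d: "\<And>l. l < n \<Longrightarrow> d l \<le> s"
  shows "qform (spec_mat n U d) v \<le> s * sqnorm v"
proof -
  have y: "U\<^sup>\<dagger> * v \<in> carrier_mat n 1"
    using unitary_carrier[OF U] v by (auto intro!: mult_carrier_mat[of _ n n _ 1])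
  have "qform (spec_mat n U d) v \<le> s * sqnorm (U\<^sup>\<dagger> * v)"
    unfolding qform_spec[OF unitary_carrier[OF U] v] sqnorm_eq[OF y] sum_distrib_left
    by (intro sum_mono mult_right_mono) (auto simp: d)
  thus ?thesis by (simp add: sqnorm_unitary[OF U v])
qed

lemma qform_conj:
  assumes "M \<in> carrier_mat n n" "N \<in> carrier_mat n n" "v \<in> carrier_mat n 1"
  shows "qform (M\<^sup>\<dagger> * (N * M)) v = qform N (M * v)"
  unfolding qform_def using assms
  by (simp add: adjoint_mult[of _ n n _ 1] assoc_mult_mat[of _ n n _ n _ n] assoc_mult_mat[of _ n n _ n _ 1]
      assoc_mult_mat[of _ 1 n _ n _ n] assoc_mult_mat[of _ 1 n _ n _ 1]
      mult_carrier_mat[of _ n n _ n] mult_carrier_mat[of _ n n _ 1])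

lemma sqnorm_spec_mult:
  assumes U: "unitary_mat n U" and v: "v \<in> carrier_mat n 1"
  shows "sqnorm (spec_mat n U d * v) = qform (spec_mat n U (\<lambda>l. (d l)\<^sup>2)) v"
proof -
  note cU = unitary_carrier[OF U]
  have "(spec_mat n U d * v)\<^sup>\<dagger> * (spec_mat n U d * v) = v\<^sup>\<dagger> * ((spec_mat n U d * spec_mat n U d) * v)"
    using cU v by (simp add: adjoint_mult[of _ n n _ 1] spec_mat_adjoint assoc_mult_mat[of _ n n _ n _ 1]
      assoc_mult_mat[of _ 1 n _ n _ 1] mult_carrier_mat[of _ n n _ 1] del: One_nat_def)
  thus ?thesis by (simp add: sqnorm_def qform_def spec_mat_mult[OF U] power2_eq_square)
qed

text \<open>Dimension count for the minimax argument: \<open>j\<close> homogeneous equations in the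
  \<open>j + 1\<close> unknowns \<open>y 0, ..., y j\<close> have a nonzero solution. A zero row
  pads the coefficient matrix to a square one, so that its determinant vanishes.\<close>

lemma kernel_vector:
  fixes G :: "complex mat"
  assumes j: "j < n" and G: "G \<in> carrier_mat n n"
  obtains y where "y \<in> carrier_mat n 1" "\<And>l. j < l \<Longrightarrow> l < n \<Longrightarrow> y $$ (l, 0) = 0" "0 < sqnorm y"
    "\<And>l. l < j \<Longrightarrow> (G * y) $$ (l, 0) = 0"
proof -
  define K where "K = mat (Suc j) (Suc j) (\<lambda>(l, r). if l < j then G $$ (l, r) else 0)"
  have K: "K \<in> carrier_mat (Suc j) (Suc j)" by (simp add: K_def)
  have "det K = 0"
    by (subst laplace_expansion_row[OF K, of j]) (auto simp: K_def)
  then obtain u where u: "u \<in> carrier_vec (Suc j)" "u \<noteq> 0\<^sub>v (Suc j)" and Ku: "K *\<^sub>v u = 0\<^sub>v (Suc j)"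
    using det_0_iff_vec_prod_zero[OF K] by blast
  obtain r where r: "r \<le> j" "u $ r \<noteq> 0"
    using u by (metis carrier_vecD eq_vecI index_zero_vec less_Suc_eq_le)
  define y where "y = mat n 1 (\<lambda>(l, _). if l \<le> j then u $ l else 0)"
  have y: "y \<in> carrier_mat n 1" by (simp add: y_def)
  show thesis
  proof
    show "y \<in> carrier_mat n 1" by (rule y)
    show "y $$ (l, 0) = 0" if "j < l" "l < n" for l using that by (simp add: y_def)
    have "0 < (cmod (y $$ (r, 0)))\<^sup>2" using r j by (simp add: y_def)
    also have "\<dots> \<le> sqnorm y"
      unfolding sqnorm_eq[OF y] using r j by (intro member_le_sum) auto
    finally show "0 < sqnorm y" .
    show "(G * y) $$ (l, 0) = 0" if l: "l < j" for l
    proof -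
      have "(G * y) $$ (l, 0) = (\<Sum>r<n. G $$ (l, r) * y $$ (r, 0))"
        using l j G y by (subst index_mult_mat_sum[of _ n n _ 1]) auto
      also have "\<dots> = (\<Sum>r<Suc j. G $$ (l, r) * u $ r)"
        using j by (intro sum.mono_neutral_cong_right) (auto simp: y_def)
      also have "\<dots> = (K *\<^sub>v u) $ l"
        using l u by (simp add: K_def scalar_prod_def atLeast0LessThan del: sum.lessThan_Suc)
      finally show ?thesis using l by (simp add: Ku)
    qed
  qed
qed

lemma spec_mat_smult:
  assumes U: "U \<in> carrier_mat n n"
  shows "complex_of_real r \<cdot>\<^sub>m spec_mat n U d = spec_mat n U (\<lambda>i. r * d i)"
  using U by (intro eq_matI) (auto simp: index_spec_mat sum_distrib_left mult_ac)

section \<open>Domination for truncations and their weighted geometric means\<close>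

context spectral_pair
begin

text \<open>The bound \<open>x j \<le> (min (c j) s)^2\<close> is proved for each eigenvalue by
  testing on one vector \<open>v\<close>. Using \<open>f \<le> s\<close> for both factors gives
  \<open>s^2\<close>. For \<open>(c j)^2\<close>, write \<open>R = S * N\<close> with
  \<open>N\<close> a contraction and replace \<open>f\<close> by the identity in the
  \<open>B\<close> factor: the form of \<open>T f\<close> at \<open>v\<close> is then at most that
  of the square of \<open>C\<close> at \<open>N * v\<close>.\<close>

lemma dominated_min:
  assumes s: "0 < s"
  shows "dominated (\<lambda>x. min x s)"
proof -
  define f where "f = (\<lambda>x. min x s)"
  have f: "0 \<le> f x" "f x \<le> x" "f x \<le> s" if "0 \<le> x" for x using that s by (auto simp: f_def)
  obtain H x where H: "unitary_mat n H" and TH: "T f = spec_mat n H x"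
    and x0: "\<And>i. i < n \<Longrightarrow> 0 \<le> x i" and xm: "\<And>i j. i \<le> j \<Longrightarrow> j < n \<Longrightarrow> x j \<le> x i"
    using T_spectral[of f] f by metis
  note cH = unitary_carrier[OF H]
  define R where "R = FA (\<lambda>x. sqrt (f x))"
  \<comment> \<open>At \<open>x = 0\<close> the quotient is 0 by the convention for division, in
    agreement with \<open>R\<close>, because \<open>f 0 = 0\<close>.\<close>
  define N where "N = FA (\<lambda>x. sqrt (f x / x))"
  define S where "S = FA sqrt"
  have car [simp]: "R \<in> carrier_mat n n" "N \<in> carrier_mat n n" "S \<in> carrier_mat n n"
    by (auto simp: R_def S_def N_def)
  have adj: "R\<^sup>\<dagger> = R" "S\<^sup>\<dagger> = S" by (auto simp: R_def S_def)
  have SN: "S * N = R"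
    unfolding S_def N_def R_def FA_mult by (rule FA_cong) (use s in \<open>auto simp: f_def simp flip: real_sqrt_mult\<close>)
  have le: "x j \<le> (f (c j))\<^sup>2" if j: "j < n" for j
  proof -
    have cG: "W\<^sup>\<dagger> * (N * H) \<in> carrier_mat n n"
      using cW cH by (auto intro!: mult_carrier_mat[of _ n n _ n])
    \<comment> \<open>The vector \<open>v = H * y\<close> lies in the span of the first
      \<open>j + 1\<close> eigenvectors of \<open>T f\<close>, where the form of \<open>T f\<close>
      is at least \<open>x j\<close>, while \<open>N * v\<close> is orthogonal to the first
      \<open>j\<close> columns of \<open>W\<close>, where the form of the square of \<open>C\<close>
      is at most \<open>(c j)^2\<close>.\<close>
    obtain y where y: "y \<in> carrier_mat n 1" and y0: "\<And>l. j < l \<Longrightarrow> l < n \<Longrightarrow> y $$ (l, 0) = 0"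
      and ypos: "0 < sqnorm y" and Gy: "\<And>l. l < j \<Longrightarrow> ((W\<^sup>\<dagger> * (N * H)) * y) $$ (l, 0) = 0"
      using kernel_vector[OF j cG] by blast
    define v where "v = H * y"
    have v: "v \<in> carrier_mat n 1" using cH y by (auto simp: v_def intro!: mult_carrier_mat[of _ n n _ 1])
    have Nv: "N * v \<in> carrier_mat n 1" and Rv: "R * v \<in> carrier_mat n 1"
      by (rule mult_carrier_mat[OF car(2) v], rule mult_carrier_mat[OF car(1) v])
    have Hv: "H\<^sup>\<dagger> * v = y"
    proof -
      have "H\<^sup>\<dagger> * v = (H\<^sup>\<dagger> * H) * y"
        using cH y unfolding v_def by (simp add: assoc_mult_mat[of _ n n _ n _ 1])
      thus ?thesis using y by (simp add: unitary_left[OF H])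
    qed
    have yv: "sqnorm y = sqnorm v" using sqnorm_unitary[OF H v] by (simp add: Hv)
    have "x j * sqnorm v = (\<Sum>l<n. x j * (cmod (y $$ (l, 0)))\<^sup>2)"
      unfolding yv[symmetric] sqnorm_eq[OF y] by (simp add: sum_distrib_left)
    also have "\<dots> \<le> (\<Sum>l<n. x l * (cmod (y $$ (l, 0)))\<^sup>2)"
    proof (rule sum_mono)
      fix l assume "l \<in> {..<n}"
      thus "x j * (cmod (y $$ (l, 0)))\<^sup>2 \<le> x l * (cmod (y $$ (l, 0)))\<^sup>2"
        using xm[of l j] y0[of l] j by (cases "l \<le> j") (auto intro: mult_right_mono)
    qed
    also have "\<dots> = qform (T f) v" unfolding TH qform_spec[OF cH v] Hv ..
    also have "\<dots> = qform (FB f) (R * v)"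
      unfolding T_def R_def[symmetric] using qform_conj[of R n "FB f" v] v by (simp add: adj)
    finally have lower: "x j * sqnorm v \<le> qform (FB f) (R * v)" .
    have "qform (FB f) (R * v) \<le> s * sqnorm (R * v)"
      unfolding FB_def by (rule qform_spec_le[OF V Rv]) (use f b in auto)
    also have "sqnorm (R * v) \<le> s * sqnorm v"
      unfolding R_def FA_def sqnorm_spec_mult[OF U v]
      by (rule qform_spec_le[OF U v]) (use f a in auto)
    finally have "x j * sqnorm v \<le> s\<^sup>2 * sqnorm v"
      using lower s by (simp add: power2_eq_square mult_ac)
    hence xs: "x j \<le> s\<^sup>2" using ypos yv by simp
    have RS: "R * v = S * (N * v)"
      unfolding SN[symmetric] using v by (simp add: assoc_mult_mat[of _ n n _ n _ 1])
    note lower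
    also have "qform (FB f) (R * v) \<le> qform (FB (\<lambda>x. x)) (S * (N * v))"
      unfolding RS[symmetric] FB_def qform_spec[OF cV Rv]
      by (intro sum_mono mult_right_mono) (use f b in auto)
    also have "qform (FB (\<lambda>x. x)) (S * (N * v)) = qform (spec_mat n W (\<lambda>i. (c i)\<^sup>2)) (N * v)"
      using qform_conj[of S n "FB (\<lambda>x. x)" "N * v"] Nv product by (simp add: adj) (simp add: S_def FA_def FB_def)
    also have "\<dots> \<le> (c j)\<^sup>2 * sqnorm (W\<^sup>\<dagger> * (N * v))"
    proof -
      have WNv: "W\<^sup>\<dagger> * (N * v) \<in> carrier_mat n 1"
        by (rule mult_carrier_mat[OF adjoint_carrier[OF cW] Nv])
      have "(W\<^sup>\<dagger> * (N * H)) * y = W\<^sup>\<dagger> * (N * v)"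
        unfolding v_def using cW cH y
        by (simp add: assoc_mult_mat[of _ n n _ n _ 1] mult_carrier_mat[of _ n n _ n] mult_carrier_mat[of _ n n _ 1])
      hence z: "(W\<^sup>\<dagger> * (N * v)) $$ (l, 0) = 0" if "l < j" for l using Gy[OF that] by simp
      have cc: "(c l)\<^sup>2 \<le> (c j)\<^sup>2" if "j \<le> l" "l < n" for l
        using c_antimono[OF that] c that by (intro power_mono) auto
      show ?thesis
        unfolding qform_spec[OF cW Nv] sqnorm_eq[OF WNv] sum_distrib_left
      proof (rule sum_mono)
        fix l assume "l \<in> {..<n}"
        thus "(c l)\<^sup>2 * (cmod ((W\<^sup>\<dagger> * (N * v)) $$ (l, 0)))\<^sup>2 \<le> (c j)\<^sup>2 * (cmod ((W\<^sup>\<dagger> * (N * v)) $$ (l, 0)))\<^sup>2"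
          using z[of l] cc[of l] by (cases "l < j") (auto intro: mult_right_mono simp del: index_mult_mat(1))
      qed
    qed
    also have "sqnorm (W\<^sup>\<dagger> * (N * v)) = sqnorm (N * v)" by (rule sqnorm_unitary[OF W Nv])
    also have "sqnorm (N * v) \<le> 1 * sqnorm v"
      unfolding N_def FA_def sqnorm_spec_mult[OF U v]
    proof (rule qform_spec_le[OF U v])
      fix l assume "l < n"
      hence "0 \<le> a l" by (rule a)
      thus "(sqrt (f (a l) / a l))\<^sup>2 \<le> 1"
        using f[of "a l"] by (cases "a l = 0") (auto simp: divide_le_eq_1)
    qed
    finally have "x j * sqnorm v \<le> (c j)\<^sup>2 * sqnorm v"
      by (simp add: mult_left_mono)
    hence xc: "x j \<le> (c j)\<^sup>2" using ypos yv by simp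
    show ?thesis using xs xc by (auto simp: f_def min_def)
  qed
  have "cmod (det (E\<^sup>\<dagger> * (T f * E))) \<le> (\<Prod>j<k. (f (c j))\<^sup>2) * cmod (det (E\<^sup>\<dagger> * E))"
    if k: "k \<le> n" and E: "E \<in> carrier_mat n k" for k E
  proof -
    have "(\<Prod>j<k. x j) \<le> (\<Prod>j<k. (f (c j))\<^sup>2)"
      using k x0 le by (intro prod_mono) auto
    thus ?thesis
      unfolding TH using det_spec_compression_le[OF H E x0 xm]
      by (meson mult_right_mono norm_ge_zero order_trans)
  qed
  thus ?thesis unfolding dominated_def f_def by blast
qed

text \<open>\<open>T\<close> is homogeneous of degree 2, since the three factors contribute
  \<open>sqrt r\<close>, \<open>r\<close> and \<open>sqrt r\<close>. A \<open>k\<close> by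
  \<open>k\<close> determinant therefore scales by \<open>r^(2k)\<close>, as does the product of
  \<open>k\<close> squares.\<close>

lemma dominated_scale:
  assumes "dominated f" and r: "0 < r" and f: "\<And>x. 0 \<le> x \<Longrightarrow> 0 \<le> f x"
  shows "dominated (\<lambda>x. r * f x)"
proof -
  have FAr: "FA (\<lambda>x. sqrt (r * f x)) = of_real (sqrt r) \<cdot>\<^sub>m FA (\<lambda>x. sqrt (f x))"
    unfolding FA_def spec_mat_smult[OF cU] by (simp add: real_sqrt_mult)
  have FBr: "FB (\<lambda>x. r * f x) = of_real r \<cdot>\<^sub>m FB f"
    unfolding FB_def spec_mat_smult[OF cV] by simp
  have smult_smult: "x \<cdot>\<^sub>m (y \<cdot>\<^sub>m M) = (x * y) \<cdot>\<^sub>m M" for x y :: complex and M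
    by (rule eq_matI) auto
  have Tr: "T (\<lambda>x. r * f x) = of_real (r\<^sup>2) \<cdot>\<^sub>m T f"
  proof -
    have "T (\<lambda>x. r * f x) = (of_real (sqrt r) * (of_real r * of_real (sqrt r))) \<cdot>\<^sub>m T f"
      unfolding T_def FAr FBr
      by (simp add: mult_smult_assoc_mat[of _ n n _ n] mult_smult_distrib[of _ n n _ n]
          mult_carrier_mat[of _ n n _ n] smult_smult mult.assoc)
    also have "of_real (sqrt r) * (of_real r * of_real (sqrt r)) = (of_real (r\<^sup>2) :: complex)"
      using r by (simp add: power2_eq_square flip: of_real_mult)
    finally show ?thesis .
  qed
  have "cmod (det (E\<^sup>\<dagger> * (T (\<lambda>x. r * f x) * E))) \<le> (\<Prod>j<k. (r * f (c j))\<^sup>2) * cmod (det (E\<^sup>\<dagger> * E))"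
    if k: "k \<le> n" and E: "E \<in> carrier_mat n k" for k E
  proof -
    have "E\<^sup>\<dagger> * (T (\<lambda>x. r * f x) * E) = of_real (r\<^sup>2) \<cdot>\<^sub>m (E\<^sup>\<dagger> * (T f * E))"
      unfolding Tr using E
      by (simp add: mult_smult_assoc_mat[of _ n n _ k] mult_smult_distrib[of _ k n _ k] mult_carrier_mat[of _ n n _ k])
    moreover have "dim_col (E\<^sup>\<dagger> * (T f * E)) = k" using E by simp
    ultimately have "cmod (det (E\<^sup>\<dagger> * (T (\<lambda>x. r * f x) * E))) = (r\<^sup>2) ^ k * cmod (det (E\<^sup>\<dagger> * (T f * E)))"
      by (simp add: norm_mult norm_power)
    also have "\<dots> \<le> (r\<^sup>2) ^ k * ((\<Prod>j<k. (f (c j))\<^sup>2) * cmod (det (E\<^sup>\<dagger> * E)))"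
      using assms(1) k E by (intro mult_left_mono) (auto simp: dominated_def)
    also have "\<dots> = (\<Prod>j<k. (r * f (c j))\<^sup>2) * cmod (det (E\<^sup>\<dagger> * E))"
      by (simp add: power_mult_distrib prod.distrib)
    finally show ?thesis .
  qed
  thus ?thesis unfolding dominated_def by blast
qed

text \<open>One truncation is split off as the second argument of a two-factor weighted mean with
  exponent \<open>t = w s\<close>; the remaining weights, divided by \<open>1 - t\<close>, again sum
  to 1.\<close>

lemma dominated_prod_min:
  assumes "finite S" "S \<noteq> {}" "\<And>s. s \<in> S \<Longrightarrow> 0 < s" "\<And>s. s \<in> S \<Longrightarrow> 0 \<le> w s" "sum w S = 1"
  shows "dominated (\<lambda>x. \<Prod>s\<in>S. min x s powr w s)"
  using assms
proof (induction S arbitrary: w rule: finite_ne_induct)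
  case (singleton s)
  show ?case
    by (rule dominated_cong[OF _ dominated_min[of s]]) (use singleton in auto)
next
  case (insert s F)
  show ?case
  \<comment> \<open>No renormalization is possible in this case, but all other weights vanish. Their
    factors are 1 for \<open>x > 0\<close>; at \<open>x = 0\<close> both sides are 0.\<close>
  proof (cases "w s = 1")
    case True
    have "sum w F = 0" using insert True by simp
    hence w0: "w r = 0" if "r \<in> F" for r
      using insert that by (auto simp: sum_nonneg_eq_0_iff)
    have Fpos: "\<And>r. r \<in> F \<Longrightarrow> 0 < r" using insert by auto
    have "min x s = (\<Prod>r\<in>insert s F. min x r powr w r)" if "0 \<le> x" for x
    proof (cases "x = 0")
      case True
      moreover have "0 < s" using insert by auto
      ultimately show ?thesis using insert.hyps by simp
    next
      case False
      have "(\<Prod>r\<in>F. min x r powr w r) = (\<Prod>r\<in>F. 1)"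
        using False that Fpos w0 by (intro prod.cong refl) (auto simp: min_def dest: Fpos)
      moreover have "0 < s" using insert by auto
      ultimately show ?thesis using insert.hyps that False \<open>w s = 1\<close> by simp
    qed
    thus ?thesis by (rule dominated_cong[OF _ dominated_min[of s]]) (use insert in auto)
  next
    case False
    let ?t = "w s"
    have Fsum: "sum w F = 1 - ?t" using insert by simp
    have "0 \<le> sum w F" using insert by (intro sum_nonneg) auto
    hence t: "0 \<le> ?t" "?t < 1" using insert False Fsum by auto
    have Fpos: "\<And>r. r \<in> F \<Longrightarrow> 0 < r" and s: "0 < s" using insert by auto
    define p where "p = (\<lambda>x. \<Prod>r\<in>F. min x r powr (w r / (1 - ?t)))"
    have "dominated p" unfolding p_def
      by (rule insert.IH) (use insert t Fsum in \<open>auto simp flip: sum_divide_distrib\<close>)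
    moreover have "dominated (\<lambda>x. min x s)" by (rule dominated_min[OF s])
    moreover obtain r where "r \<in> F" using insert.hyps by auto
    \<comment> \<open>On the nonnegative reals both functions vanish only at 0. For \<open>p\<close>
      this uses that \<open>F\<close> is nonempty, an empty product being 1.\<close>
    hence "p x = 0 \<longleftrightarrow> min x s = 0" if "0 \<le> x" for x
      using that s insert.hyps less_imp_le[OF Fpos]
      by (auto simp: p_def min_def intro!: bexI[of _ r] dest: Fpos)
    ultimately have "dominated (\<lambda>x. p x powr (1 - ?t) * min x s powr ?t)"
      using s t by (intro dominated_powr_mult) (auto simp: p_def intro!: prod_nonneg)
    moreover have "p x powr (1 - ?t) * min x s powr ?t = (\<Prod>r\<in>insert s F. min x r powr w r)" for x
      using insert.hyps t by (simp add: p_def prod_powr_distrib powr_powr mult.commute)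
    ultimately show ?thesis by simp
  qed
qed

end

subsection \<open>Geometric concavity of \<open>1 - exp (- x)\<close>\<close>

definition one_minus_exp :: "real \<Rightarrow> real" where "one_minus_exp x = 1 - exp (- x)"

text \<open>In the variable \<open>t = ln x\<close> the derivative of \<open>ln (1 - exp (- x))\<close> is \<open>x / (exp x - 1)\<close>.\<close>

definition log_slope :: "real \<Rightarrow> real" where "log_slope x = x / (exp x - 1)"

lemma one_minus_exp_pos: "0 < x \<Longrightarrow> 0 < one_minus_exp x"
  by (simp add: one_minus_exp_def)

lemma log_slope_bounds:
  assumes "0 < x"
  shows "0 \<le> log_slope x" "log_slope x \<le> 1"
proof -
  have "x \<le> exp x - 1" using exp_ge_add_one_self[of x] by linarith
  with assms show "0 \<le> log_slope x" "log_slope x \<le> 1" by (auto simp: log_slope_def divide_le_eq_1)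
qed

text \<open>The reciprocal \<open>(exp x - 1) / x\<close> is the slope of the chord of
  \<open>exp\<close> from 0 to \<open>x\<close>, which increases by convexity.\<close>

lemma log_slope_antimono:
  assumes "0 < x" "x \<le> y"
  shows "log_slope y \<le> log_slope x"
proof -
  have "exp ((1 - x / y) * 0 + (x / y) * y) \<le> (1 - x / y) * exp 0 + (x / y) * exp y"
    using convex_onD[OF exp_convex, of "x / y" 0 y] assms by simp
  hence "exp x - 1 \<le> x / y * (exp y - 1)" using assms by (simp add: algebra_simps)
  hence "(exp x - 1) * y \<le> x * (exp y - 1)" using assms by (simp add: field_simps)
  thus ?thesis using assms by (simp add: log_slope_def field_simps)
qed

lemma ln_one_minus_exp_mvt:
  assumes "0 < x" "x < y"
  obtains z where "x < z" "z < y" "ln (one_minus_exp y) - ln (one_minus_exp x) = log_slope z * (ln y - ln x)"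
proof -
  define L where "L t = ln (1 - exp (- exp t))" for t :: real
  have "(L has_real_derivative log_slope (exp t)) (at t)" for t
    unfolding L_def log_slope_def
    by (auto intro!: derivative_eq_intros simp: exp_minus field_simps)
  then obtain t where t: "ln x < t" "t < ln y" "L (ln y) - L (ln x) = (ln y - ln x) * log_slope (exp t)"
    using MVT2[of "ln x" "ln y" L "\<lambda>t. log_slope (exp t)"] assms by auto
  have "x < exp t" using t(1) assms by (metis exp_less_mono exp_ln)
  moreover have "exp t < y" using t(2) assms by (metis exp_less_mono exp_ln order_less_trans)
  ultimately show thesis
    using t(3) assms by (intro that[of "exp t"]) (auto simp: L_def one_minus_exp_def mult.commute)
qed

text \<open>On a finite set, \<open>ln one_minus_exp\<close> agrees as a function of \<open>ln x\<close> with a concave piecewise linear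
  function, whose drops of slope at the nodes are the weights \<open>w\<close>. The weight of the largest
  node is the slope of the last piece.\<close>

lemma one_minus_exp_prod_min:
  assumes "finite S" "S \<noteq> {}" "\<And>s. s \<in> S \<Longrightarrow> 0 < s"
  shows "\<exists>w r. 0 < r \<and> (\<forall>s\<in>S. 0 \<le> w s) \<and> sum w S = 1 \<and>
    (\<forall>x\<in>S. one_minus_exp x = r * (\<Prod>s\<in>S. min x s powr w s)) \<and>
    (\<forall>y. Max S < y \<longrightarrow> ln (one_minus_exp y) - ln (one_minus_exp (Max S)) \<le> w (Max S) * (ln y - ln (Max S)))"
  using assms
proof (induction S rule: finite_linorder_max_induct)
  case (insert y S)
  have y: "0 < y" using insert by auto
  show ?case
  proof (cases "S = {}")
    case True
    have "ln (one_minus_exp z) - ln (one_minus_exp y) \<le> 1 * (ln z - ln y)" if yz: "y < z" for z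
    proof -
      obtain u where "y < u" "ln (one_minus_exp z) - ln (one_minus_exp y) = log_slope u * (ln z - ln y)"
        using ln_one_minus_exp_mvt[OF y yz] by blast
      thus ?thesis using log_slope_bounds[of u] y yz by (simp add: mult_left_le_one_le)
    qed
    thus ?thesis
      using True y one_minus_exp_pos[OF y] by (intro exI[of _ "\<lambda>_. 1"] exI[of _ "one_minus_exp y / y"]) auto
  next
    case False
    have Spos: "\<And>s. s \<in> S \<Longrightarrow> 0 < s" using insert by auto
    obtain w r where r: "0 < r" and w0: "\<And>s. s \<in> S \<Longrightarrow> 0 \<le> w s" and w1: "sum w S = 1"
      and eq: "\<And>x. x \<in> S \<Longrightarrow> one_minus_exp x = r * (\<Prod>s\<in>S. min x s powr w s)"
      and last: "\<And>y. Max S < y \<Longrightarrow> ln (one_minus_exp y) - ln (one_minus_exp (Max S)) \<le> w (Max S) * (ln y - ln (Max S))"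
      using insert.IH[OF False Spos] by blast
    define m where "m = Max S"
    have m: "m \<in> S" "\<And>s. s \<in> S \<Longrightarrow> s \<le> m" "0 < m" "m < y"
      using False insert Spos by (auto simp: m_def)
    obtain z where z: "m < z" "z < y" "ln (one_minus_exp y) - ln (one_minus_exp m) = log_slope z * (ln y - ln m)"
      using ln_one_minus_exp_mvt[OF m(3,4)] by blast
    define \<sigma> where "\<sigma> = log_slope z"
    have \<sigma>0: "0 \<le> \<sigma>" using log_slope_bounds[of z] z m by (simp add: \<sigma>_def)
    have "\<sigma> * (ln y - ln m) \<le> w m * (ln y - ln m)"
      using last[of y] m z by (simp add: m_def \<sigma>_def)
    hence \<sigma>w: "\<sigma> \<le> w m" using m by simp
    have yS: "y \<notin> S" using insert by auto
    define w' where "w' = w(m := w m - \<sigma>, y := \<sigma>)"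
    have MaxI: "Max (insert y S) = y" using insert m False by (intro Max_eqI) (auto intro: less_imp_le)
    have w'S: "w' s = w s" if "s \<in> S - {m}" for s using that yS by (auto simp: w'_def)
    have w'm: "w' m = w m - \<sigma>" and w'y: "w' y = \<sigma>" using m by (auto simp: w'_def)
    have "0 \<le> w' s" if "s \<in> insert y S" for s
      using that w0 \<sigma>0 \<sigma>w by (auto simp: w'_def)
    moreover have "sum w' (insert y S) = 1"
    proof -
      have "sum w' (insert y S) = \<sigma> + (w m - \<sigma> + sum w' (S - {m}))"
        using yS insert.hyps m by (simp add: w'y sum.remove[of S m w'] w'm)
      also have "sum w' (S - {m}) = sum w (S - {m})" by (intro sum.cong w'S) auto
      finally show ?thesis using w1 insert.hyps m by (simp add: sum.remove[of S m w])
    qed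
    moreover have "one_minus_exp x = r * (\<Prod>s\<in>insert y S. min x s powr w' s)" if x: "x \<in> insert y S" for x
    proof -
      have "(\<Prod>s\<in>insert y S. min x s powr w' s) =
          min x y powr \<sigma> * (min x m powr (w m - \<sigma>) * (\<Prod>s\<in>S - {m}. min x s powr w s))"
        using yS insert.hyps m by (simp add: w'y prod.remove[of S m] w'm w'S)
      also have "\<dots> = (min x y / min x m) powr \<sigma> * (\<Prod>s\<in>S. min x s powr w s)"
        using insert.hyps m x Spos y
        by (simp add: prod.remove[of S m] powr_diff powr_divide)
      finally have split: "(\<Prod>s\<in>insert y S. min x s powr w' s) =
          (min x y / min x m) powr \<sigma> * (\<Prod>s\<in>S. min x s powr w s)" .
      show ?thesis
      proof (cases "x = y")
        case True
        have "(\<Prod>s\<in>S. min y s powr w s) = (\<Prod>s\<in>S. min m s powr w s)"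
          using m by (intro prod.cong refl) (force simp: min_def)
        hence "r * (\<Prod>s\<in>insert y S. min x s powr w' s) = (y / m) powr \<sigma> * one_minus_exp m"
          unfolding split using True m eq[OF m(1)] by (simp add: min_absorb2)
        also have "(y / m) powr \<sigma> = exp (ln (one_minus_exp y) - ln (one_minus_exp m))"
          using y m z(3) by (simp add: powr_def ln_div \<sigma>_def)
        also have "\<dots> * one_minus_exp m = one_minus_exp y"
          using one_minus_exp_pos[OF y] one_minus_exp_pos[OF m(3)] by (simp add: exp_diff)
        finally show ?thesis using True by simp
      next
        case False
        hence "x \<in> S" using x by simp
        hence "min x y = x" "min x m = x" "0 < x" using m Spos by force+
        thus ?thesis unfolding split using eq[OF \<open>x \<in> S\<close>] by simp
      qed
    qed
    moreover have "ln (one_minus_exp u) - ln (one_minus_exp y) \<le> w' y * (ln u - ln y)" if yu: "y < u" for u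
    proof -
      obtain v where v: "y < v" "ln (one_minus_exp u) - ln (one_minus_exp y) = log_slope v * (ln u - ln y)"
        using ln_one_minus_exp_mvt[OF y yu] by blast
      have "log_slope v \<le> \<sigma>" unfolding \<sigma>_def using v z m by (intro log_slope_antimono) auto
      thus ?thesis unfolding v w'y using y yu by (intro mult_right_mono) auto
    qed
    ultimately show ?thesis using r MaxI by (intro exI[of _ w'] exI[of _ r]) auto
  qed
qed simp

context spectral_pair
begin

lemma dominated_one_minus_exp: "dominated one_minus_exp"
proof -
  define S where "S = {x \<in> a ` {..<n} \<union> b ` {..<n} \<union> c ` {..<n}. 0 < x}"
  define S' where "S' = insert 1 S"
  have S': "finite S'" "S' \<noteq> {}" "\<And>s. s \<in> S' \<Longrightarrow> 0 < s" by (auto simp: S'_def S_def)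
  obtain w r where r: "0 < r" and w: "\<And>s. s \<in> S' \<Longrightarrow> 0 \<le> w s" "sum w S' = 1"
    and eq: "\<And>x. x \<in> S' \<Longrightarrow> one_minus_exp x = r * (\<Prod>s\<in>S'. min x s powr w s)"
    using one_minus_exp_prod_min[OF S'] by blast
  have "dominated (\<lambda>x. r * (\<Prod>s\<in>S'. min x s powr w s))"
    using S' w r by (intro dominated_scale dominated_prod_min prod_nonneg) auto
  thus ?thesis
  proof (rule dominated_cong_spectrum[rotated])
    fix x assume x: "x \<in> a ` {..<n} \<union> b ` {..<n} \<union> c ` {..<n}"
    hence "0 \<le> x" using a b c by auto
    show "r * (\<Prod>s\<in>S'. min x s powr w s) = one_minus_exp x"
    proof (cases "x = 0")
      case True
      have "(\<Prod>s\<in>S'. min x s powr w s) = 0"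
        using S' True by (intro prod_zero) (auto intro!: bexI[of _ 1] simp: S'_def)
      thus ?thesis using True by (simp add: one_minus_exp_def)
    next
      case False
      hence "x \<in> S'" using x \<open>0 \<le> x\<close> by (auto simp: S'_def S_def)
      thus ?thesis using eq by simp
    qed
  qed
qed

end

subsection \<open>From products to sums\<close>

lemma abel_sum_nonneg:
  fixes x l :: "nat \<Rightarrow> real"
  assumes "\<And>i j. i \<le> j \<Longrightarrow> j \<le> m \<Longrightarrow> x j \<le> x i" "\<And>k. k \<le> Suc m \<Longrightarrow> 0 \<le> (\<Sum>j<k. l j)"
  shows "x m * (\<Sum>j<Suc m. l j) \<le> (\<Sum>j<Suc m. x j * l j)"
  using assms
proof (induction m)
  case (Suc m)
  have "x (Suc m) * (\<Sum>j<Suc m. l j) \<le> x m * (\<Sum>j<Suc m. l j)"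
    using Suc.prems(1)[of m "Suc m"] Suc.prems(2)[of "Suc m"] by (intro mult_right_mono) auto
  also have "\<dots> \<le> (\<Sum>j<Suc m. x j * l j)"
    by (rule Suc.IH) (use Suc.prems in auto)
  finally show ?case by (simp add: distrib_left)
qed simp

lemma sum_le_of_prod_le:
  fixes x y :: "nat \<Rightarrow> real"
  assumes x: "\<And>i. i < n \<Longrightarrow> 0 \<le> x i" "\<And>i j. i \<le> j \<Longrightarrow> j < n \<Longrightarrow> x j \<le> x i"
    and y: "\<And>i. i < n \<Longrightarrow> 0 \<le> y i"
    and prod: "\<And>k. k \<le> n \<Longrightarrow> (\<Prod>j<k. x j) \<le> (\<Prod>j<k. y j)"
  shows "(\<Sum>j<n. x j) \<le> (\<Sum>j<n. y j)"
  using assms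
proof (induction n)
  case (Suc m)
  show ?case
  proof (cases "x m = 0")
    case True
    have "(\<Sum>j<m. x j) \<le> (\<Sum>j<m. y j)" by (rule Suc.IH) (use Suc.prems in auto)
    thus ?thesis using True Suc.prems(3)[of m] by simp
  next
    case False
    hence "0 < x m" using Suc.prems(1)[of m] by simp
    hence xp: "0 < x j" if "j \<le> m" for j using Suc.prems(2)[of j m] that by simp
    have "0 < (\<Prod>j<Suc m. x j)" using xp by (intro prod_pos) auto
    hence "(\<Prod>j<Suc m. y j) \<noteq> 0" using Suc.prems(4)[of "Suc m"] by linarith
    hence yp: "0 < y j" if "j \<le> m" for j
      using Suc.prems(3)[of j] that by (auto simp: order_less_le)
    define l where "l j = ln (y j / x j)" for j
    have lsum: "0 \<le> (\<Sum>j<k. l j)" if k: "k \<le> Suc m" for k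
    proof -
      have p: "0 < x j" "0 < y j" if "j < k" for j using xp[of j] yp[of j] k that by auto
      have px: "0 < (\<Prod>j<k. x j)" using p by (intro prod_pos) auto
      have "(\<Sum>j<k. l j) = ln (\<Prod>j<k. y j / x j)"
        unfolding l_def by (intro ln_prod[symmetric]) (auto dest: p)
      also have "(\<Prod>j<k. y j / x j) = (\<Prod>j<k. y j) / (\<Prod>j<k. x j)" by (rule prod_dividef)
      finally show ?thesis using Suc.prems(4)[OF k] px by (simp add: le_divide_eq_1)
    qed
    have "0 \<le> x m * (\<Sum>j<Suc m. l j)" using lsum[of "Suc m"] xp[of m] by simp
    also have "\<dots> \<le> (\<Sum>j<Suc m. x j * l j)"
      by (rule abel_sum_nonneg) (use Suc.prems lsum in auto)
    also have "\<dots> \<le> (\<Sum>j<Suc m. y j - x j)"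
    proof (rule sum_mono)
      fix j assume "j \<in> {..<Suc m}"
      hence p: "0 < x j" "0 < y j" using xp yp by auto
      have "x j * l j \<le> x j * (y j / x j - 1)"
        unfolding l_def using p by (intro mult_left_mono ln_le_minus_one) auto
      also have "x j * (y j / x j - 1) = y j - x j" using p by (simp add: field_simps)
      finally show "x j * l j \<le> y j - x j" .
    qed
    finally show ?thesis by (simp add: sum_subtractf)
  qed
qed simp

lemma trace_spec:
  assumes H: "unitary_mat n H"
  shows "mat_tr n (spec_mat n H x) = of_real (\<Sum>l<n. x l)"
proof -
  note cH = unitary_carrier[OF H]
  have "mat_tr n (spec_mat n H x) = (\<Sum>i<n. \<Sum>l<n. of_real (x l) * (cnj (H $$ (i, l)) * H $$ (i, l)))"
    unfolding mat_tr_def by (intro sum.cong refl) (simp add: index_spec_mat[OF cH] mult_ac)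
  also have "\<dots> = (\<Sum>l<n. of_real (x l) * (H\<^sup>\<dagger> * H) $$ (l, l))"
    using cH by (subst sum.swap) (auto intro!: sum.cong simp: index_mult_mat_sum[of _ n n _ n] sum_distrib_left simp del: index_mult_mat(1))
  finally show ?thesis by (simp add: unitary_left[OF H])
qed

lemma trace_mult_commute:
  assumes "A \<in> carrier_mat n n" "B \<in> carrier_mat n n"
  shows "mat_tr n (A * B) = mat_tr n (B * A)"
proof -
  have "mat_tr n (A * B) = (\<Sum>i<n. \<Sum>j<n. A $$ (i, j) * B $$ (j, i))"
    unfolding mat_tr_def using assms by (intro sum.cong refl index_mult_mat_sum) auto
  also have "\<dots> = (\<Sum>j<n. \<Sum>i<n. B $$ (j, i) * A $$ (i, j))"
    by (subst sum.swap) (simp add: mult.commute)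
  also have "\<dots> = mat_tr n (B * A)"
    unfolding mat_tr_def using assms by (intro sum.cong refl index_mult_mat_sum[symmetric]) auto
  finally show ?thesis .
qed

context spectral_pair
begin

lemma trace_dominated:
  assumes f: "\<And>x. 0 \<le> x \<Longrightarrow> 0 \<le> f x" and dom: "dominated f"
  shows "Re (mat_tr n (FA f * FB f)) \<le> (\<Sum>j<n. (f (c j))\<^sup>2)"
proof -
  obtain H x where H: "unitary_mat n H" and TH: "T f = spec_mat n H x"
    and x0: "\<And>i. i < n \<Longrightarrow> 0 \<le> x i" and xm: "\<And>i j. i \<le> j \<Longrightarrow> j < n \<Longrightarrow> x j \<le> x i"
    using T_spectral[of f] f by metis
  have "(\<Prod>j<k. x j) \<le> (\<Prod>j<k. (f (c j))\<^sup>2)" if k: "k \<le> n" for k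
  proof -
    obtain E where E: "E \<in> carrier_mat n k" and EE: "E\<^sup>\<dagger> * E = 1\<^sub>m k" and TE: "T f * E = E * rdiag k x"
      unfolding TH using spec_eigen_columns[OF H k] by metis
    have "E\<^sup>\<dagger> * (E * rdiag k x) = (E\<^sup>\<dagger> * E) * rdiag k x"
      using E by (simp add: assoc_mult_mat[of _ k n _ k _ k])
    hence "E\<^sup>\<dagger> * (T f * E) = rdiag k x"
      by (simp add: TE EE left_mult_one_mat[of _ k k])
    hence "cmod (det (rdiag k x)) \<le> (\<Prod>j<k. (f (c j))\<^sup>2) * cmod (det (E\<^sup>\<dagger> * E))"
      using dom k E unfolding dominated_def by metis
    hence "\<bar>\<Prod>j<k. x j\<bar> \<le> (\<Prod>j<k. (f (c j))\<^sup>2)"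
      by (simp add: det_rdiag EE flip: of_real_prod)
    thus ?thesis by simp
  qed
  hence "(\<Sum>j<n. x j) \<le> (\<Sum>j<n. (f (c j))\<^sup>2)"
    using x0 xm by (intro sum_le_of_prod_le) auto
  moreover have "mat_tr n (FA f * FB f) = mat_tr n (T f)"
  proof -
    let ?R = "FA (\<lambda>x. sqrt (f x))"
    have RR: "?R * ?R = FA f" unfolding FA_mult by (rule FA_cong) (use f in auto)
    have "mat_tr n (T f) = mat_tr n ((FB f * ?R) * ?R)"
      unfolding T_def by (rule trace_mult_commute) (auto intro!: mult_carrier_mat[of _ n n _ n])
    also have "(FB f * ?R) * ?R = FB f * FA f"
      by (simp add: assoc_mult_mat[of _ n n _ n _ n] RR)
    also have "mat_tr n (FB f * FA f) = mat_tr n (FA f * FB f)"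
      by (rule trace_mult_commute) auto
    finally show ?thesis ..
  qed
  ultimately show ?thesis by (simp add: TH trace_spec[OF H])
qed

end

subsection \<open>Matrix exponential and square root\<close>

lemma hermitian_adjoint:
  assumes "hermitian_mat n A"
  shows "A \<in> carrier_mat n n" "A\<^sup>\<dagger> = A"
proof -
  show A: "A \<in> carrier_mat n n" using assms by (simp add: hermitian_mat_def)
  show "A\<^sup>\<dagger> = A"
  proof (rule eq_matI)
    fix i j assume "i < dim_row A" "j < dim_col A"
    hence ij: "i < n" "j < n" using A by auto
    hence "A\<^sup>\<dagger> $$ (i, j) = cnj (A $$ (j, i))" using A by simp
    also have "\<dots> = A $$ (i, j)" using assms ij unfolding hermitian_mat_def by metis
    finally show "A\<^sup>\<dagger> $$ (i, j) = A $$ (i, j)" .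
  qed (use A in auto)
qed

lemma psd_qform:
  assumes A: "A \<in> carrier_mat n n" and v: "v \<in> carrier_mat n 1"
  shows "qform A v = Re (\<Sum>i<n. \<Sum>j<n. cnj (v $$ (i, 0)) * A $$ (i, j) * v $$ (j, 0))"
proof -
  have Av: "A * v \<in> carrier_mat n 1" using A v by auto
  have "(v\<^sup>\<dagger> * (A * v)) $$ (0, 0) = (\<Sum>i<n. cnj (v $$ (i, 0)) * (\<Sum>j<n. A $$ (i, j) * v $$ (j, 0)))"
    using v A Av
    by (subst index_mult_mat_sum[of _ 1 n _ 1])
       (auto simp: index_mult_mat_sum[OF A v] simp del: index_mult_mat(1) intro!: sum.cong)
  thus ?thesis by (simp add: qform_def sum_distrib_left mult.assoc)
qed

lemma psd_mat_iff_qform: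
  "psd_mat n A \<longleftrightarrow> hermitian_mat n A \<and> (\<forall>v\<in>carrier_mat n 1. 0 \<le> qform A v)"
proof (cases "hermitian_mat n A")
  case True
  note A = hermitian_adjoint(1)[OF True]
  have "(\<forall>v :: nat \<Rightarrow> complex. 0 \<le> Re (\<Sum>i<n. \<Sum>j<n. cnj (v i) * A $$ (i, j) * v j)) \<longleftrightarrow>
      (\<forall>v\<in>carrier_mat n 1. 0 \<le> qform A v)"
  proof safe
    fix v :: "complex mat" assume all: "\<forall>v :: nat \<Rightarrow> complex. 0 \<le> Re (\<Sum>i<n. \<Sum>j<n. cnj (v i) * A $$ (i, j) * v j)"
      and v: "v \<in> carrier_mat n 1"
    show "0 \<le> qform A v" unfolding psd_qform[OF A v] using all[THEN spec, of "\<lambda>i. v $$ (i, 0)"] by simp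
  next
    fix v :: "nat \<Rightarrow> complex" assume all: "\<forall>v\<in>carrier_mat n 1. 0 \<le> qform A v"
    have "0 \<le> qform A (mat n 1 (\<lambda>(i, _). v i))" using all by simp
    thus "0 \<le> Re (\<Sum>i<n. \<Sum>j<n. cnj (v i) * A $$ (i, j) * v j)"
      by (subst (asm) psd_qform[OF A]) auto
  qed
  with True show ?thesis by (simp add: psd_mat_def)
qed (simp add: psd_mat_def)

lemma psd_spec_mat:
  assumes U: "U \<in> carrier_mat n n" and d: "\<And>i. i < n \<Longrightarrow> 0 \<le> d i"
  shows "psd_mat n (spec_mat n U d)"
  unfolding psd_mat_iff_qform
proof
  show "hermitian_mat n (spec_mat n U d)"
    unfolding hermitian_mat_def using U by (auto simp: index_spec_mat mult_ac)
  show "\<forall>v\<in>carrier_mat n 1. 0 \<le> qform (spec_mat n U d) v"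
    using d by (auto simp: qform_spec[OF U] intro!: sum_nonneg mult_nonneg_nonneg simp del: One_nat_def)
qed

lemma psd_spectral:
  assumes "psd_mat n A"
  obtains U d where "unitary_mat n U" "A = spec_mat n U d" "\<And>i. i < n \<Longrightarrow> 0 \<le> d i"
    "\<And>i j. i \<le> j \<Longrightarrow> j < n \<Longrightarrow> d j \<le> d i"
proof -
  have herm: "hermitian_mat n A" and q: "\<And>v. v \<in> carrier_mat n 1 \<Longrightarrow> 0 \<le> qform A v"
    using assms by (auto simp: psd_mat_iff_qform simp del: One_nat_def)
  obtain U d where U: "unitary_mat n U" and A: "A = spec_mat n U d"
    and mono: "\<And>i j. i \<le> j \<Longrightarrow> j < n \<Longrightarrow> d j \<le> d i"
    using spectral_decomposition_antimono[OF hermitian_adjoint[OF herm]] by blast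
  note cU = unitary_carrier[OF U]
  have "0 \<le> d i" if i: "i < n" for i
  proof -
    define e :: "complex mat" where "e = mat n 1 (\<lambda>(l, _). if l = i then 1 else 0)"
    have e: "e \<in> carrier_mat n 1" by (simp add: e_def)
    have v: "U * e \<in> carrier_mat n 1" using cU e by auto
    have "U\<^sup>\<dagger> * (U * e) = (U\<^sup>\<dagger> * U) * e" using cU e by (simp add: assoc_mult_mat[of _ n n _ n _ 1])
    hence "U\<^sup>\<dagger> * (U * e) = e" using e by (simp add: unitary_left[OF U])
    hence "qform A (U * e) = (\<Sum>l<n. d l * (cmod (e $$ (l, 0)))\<^sup>2)"
      unfolding A qform_spec[OF cU v] by simp
    also have "\<dots> = (\<Sum>l<n. if l = i then d l else 0)" by (intro sum.cong) (auto simp: e_def)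
    also have "\<dots> = d i" using i by simp
    finally show ?thesis using q[OF v] by simp
  qed
  with U A mono show thesis by (intro that[of U d]) auto
qed

text \<open>The matrix \<open>Q\<close> below intertwines the two diagonal matrices; for nonnegative entries it then
  also intertwines their square roots.\<close>

lemma psd_sqrt_unique:
  assumes U: "unitary_mat n U" and d: "\<And>i. i < n \<Longrightarrow> 0 \<le> d i"
    and S: "psd_mat n S" and SS: "S * S = spec_mat n U d"
  shows "S = spec_mat n U (\<lambda>i. sqrt (d i))"
proof -
  obtain W e where W: "unitary_mat n W" and Seq: "S = spec_mat n W e" and e: "\<And>i. i < n \<Longrightarrow> 0 \<le> e i"
    using psd_spectral[OF S] by blast
  note cU = unitary_carrier[OF U] and cW = unitary_carrier[OF W]
  define Q where "Q = U\<^sup>\<dagger> * W"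
  have Q: "Q \<in> carrier_mat n n" using cU cW by (auto simp: Q_def)
  note ac = assoc_mult_mat[of _ n n _ n _ n] mult_carrier_mat[of _ n n _ n]
  have eig: "spec_mat n Y f * Y = Y * rdiag n f" if "unitary_mat n Y" for Y f
    using unitary_carrier[OF that] unitary_left[OF that] by (simp add: spec_mat_def ac)
  have eig': "Y\<^sup>\<dagger> * spec_mat n Y f = rdiag n f * Y\<^sup>\<dagger>" if "unitary_mat n Y" for Y f
  proof -
    have "Y\<^sup>\<dagger> * spec_mat n Y f = (Y\<^sup>\<dagger> * Y) * (rdiag n f * Y\<^sup>\<dagger>)"
      unfolding spec_mat_def using unitary_carrier[OF that] by (simp add: ac)
    thus ?thesis using unitary_carrier[OF that] by (simp add: unitary_left[OF that] ac)
  qed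
  have eq: "spec_mat n U d = spec_mat n W (\<lambda>i. e i * e i)"
    using SS unfolding Seq spec_mat_mult[OF W] by simp
  have "rdiag n d * Q = (U\<^sup>\<dagger> * spec_mat n U d) * W"
    unfolding eig'[OF U] Q_def using cU cW by (simp add: ac)
  also have "\<dots> = U\<^sup>\<dagger> * (spec_mat n W (\<lambda>i. e i * e i) * W)"
    unfolding eq using cU cW by (simp add: ac)
  also have "\<dots> = Q * rdiag n (\<lambda>i. e i * e i)"
    unfolding eig[OF W] Q_def using cU cW by (simp add: ac)
  finally have inter: "rdiag n d * Q = Q * rdiag n (\<lambda>i. e i * e i)" .
  have "rdiag n (\<lambda>i. sqrt (d i)) * Q = Q * rdiag n e"
  proof (rule eq_matI)
    fix i j assume "i < dim_row (Q * rdiag n e)" "j < dim_col (Q * rdiag n e)"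
    hence ij: "i < n" "j < n" using Q by auto
    have "of_real (d i) * Q $$ (i, j) = Q $$ (i, j) * of_real (e j * e j)"
      using arg_cong[OF inter, of "\<lambda>M. M $$ (i, j)"] ij Q
      by (simp add: index_rdiag_mult[of _ n n] index_mult_rdiag[of _ n n] del: index_mult_mat(1))
    hence "of_real (sqrt (d i)) * Q $$ (i, j) = Q $$ (i, j) * of_real (e j)"
    proof (cases "Q $$ (i, j) = 0")
      case False
      assume "of_real (d i) * Q $$ (i, j) = Q $$ (i, j) * of_real (e j * e j)"
      hence "(of_real (d i) :: complex) = of_real (e j * e j)" using False by simp
      hence "d i = e j * e j" by (simp only: of_real_eq_iff)
      hence "sqrt (d i) = e j" using e[OF ij(2)] by simp
      thus ?thesis by simp
    qed simp
    thus "(rdiag n (\<lambda>i. sqrt (d i)) * Q) $$ (i, j) = (Q * rdiag n e) $$ (i, j)"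
      using ij Q by (simp add: index_rdiag_mult[of _ n n] index_mult_rdiag[of _ n n] del: index_mult_mat(1))
  qed (use Q in auto)
  hence "(U\<^sup>\<dagger> * spec_mat n U (\<lambda>i. sqrt (d i))) * W = U\<^sup>\<dagger> * (S * W)"
    unfolding eig'[OF U] Seq eig[OF W] Q_def using cU cW by (simp add: ac)
  hence "U\<^sup>\<dagger> * (spec_mat n U (\<lambda>i. sqrt (d i)) * W) = U\<^sup>\<dagger> * (S * W)"
    using cU cW by (simp add: ac)
  hence "U * (U\<^sup>\<dagger> * (spec_mat n U (\<lambda>i. sqrt (d i)) * W)) * W\<^sup>\<dagger> = U * (U\<^sup>\<dagger> * (S * W)) * W\<^sup>\<dagger>"
    by simp
  moreover have "U * (U\<^sup>\<dagger> * (M * W)) * W\<^sup>\<dagger> = M" if "M \<in> carrier_mat n n" for M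
  proof -
    have "U * (U\<^sup>\<dagger> * (M * W)) * W\<^sup>\<dagger> = (U * U\<^sup>\<dagger>) * (M * (W * W\<^sup>\<dagger>))"
      using that cU cW by (simp add: ac)
    thus ?thesis using that by (simp add: unitary_right[OF U] unitary_right[OF W])
  qed
  ultimately show ?thesis using cU cW by (simp add: Seq)
qed

lemma mat_sqrt_spec:
  assumes U: "unitary_mat n U" and d: "\<And>i. i < n \<Longrightarrow> 0 \<le> d i"
  shows "mat_sqrt n (spec_mat n U d) = spec_mat n U (\<lambda>i. sqrt (d i))"
  unfolding mat_sqrt_def
proof (rule the_equality)
  have "spec_mat n U (\<lambda>i. sqrt (d i)) * spec_mat n U (\<lambda>i. sqrt (d i)) = spec_mat n U d"
    unfolding spec_mat_mult[OF U] by (rule spec_mat_cong[OF unitary_carrier[OF U]]) (use d in auto)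
  thus "psd_mat n (spec_mat n U (\<lambda>i. sqrt (d i))) \<and>
      spec_mat n U (\<lambda>i. sqrt (d i)) * spec_mat n U (\<lambda>i. sqrt (d i)) = spec_mat n U d"
    using d by (auto intro!: psd_spec_mat unitary_carrier[OF U])
qed (use psd_sqrt_unique[OF U d] in auto)

lemma spec_mat_power:
  assumes U: "unitary_mat n U"
  shows "spec_mat n U d ^\<^sub>m k = spec_mat n U (\<lambda>i. d i ^ k)"
proof (induction k)
  case 0
  show ?case using unitary_carrier[OF U] by (simp add: spec_mat_one[OF U])
next
  case (Suc k)
  thus ?case by (simp add: spec_mat_mult[OF U] mult.commute)
qed

lemma mat_exp_spec:
  assumes U: "unitary_mat n U"
  shows "mat_exp n (spec_mat n U d) = spec_mat n U (\<lambda>i. exp (d i))"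
proof (rule eq_matI)
  note cU = unitary_carrier[OF U]
  fix i j assume "i < dim_row (spec_mat n U (\<lambda>i. exp (d i)))" "j < dim_col (spec_mat n U (\<lambda>i. exp (d i)))"
  hence ij: "i < n" "j < n" using cU by auto
  have exps: "(\<lambda>k. (of_real (x ^ k) :: complex) / of_real (fact k)) sums of_real (exp x)" for x :: real
  proof -
    have "(\<lambda>k. x ^ k / fact k) sums exp x"
      using exp_converges[of x] by (simp add: divide_inverse mult.commute)
    from sums_of_real[OF this, where 'a = complex] show ?thesis by simp
  qed
  have "(\<lambda>k. \<Sum>l<n. U $$ (i, l) * (of_real (d l ^ k) / of_real (fact k)) * cnj (U $$ (j, l))) sums
      (\<Sum>l<n. U $$ (i, l) * of_real (exp (d l)) * cnj (U $$ (j, l)))"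
    by (intro sums_sum sums_mult sums_mult2 exps)
  moreover have "(\<Sum>l<n. U $$ (i, l) * (of_real (d l ^ k) / of_real (fact k)) * cnj (U $$ (j, l))) =
      (spec_mat n U d ^\<^sub>m k) $$ (i, j) / of_real (fact k)" for k
    unfolding spec_mat_power[OF U] index_spec_mat[OF cU ij] by (simp add: sum_divide_distrib)
  ultimately have "(\<lambda>k. (spec_mat n U d ^\<^sub>m k) $$ (i, j) / of_real (fact k)) sums
      spec_mat n U (\<lambda>i. exp (d i)) $$ (i, j)"
    unfolding index_spec_mat[OF cU ij, of "\<lambda>i. exp (d i)"] by (simp only:)
  thus "mat_exp n (spec_mat n U d) $$ (i, j) = spec_mat n U (\<lambda>i. exp (d i)) $$ (i, j)"
    using ij by (simp add: mat_exp_def sums_unique[symmetric])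
qed (use unitary_carrier[OF U] in \<open>auto simp: mat_exp_def\<close>)

lemma spec_mat_uminus:
  assumes U: "U \<in> carrier_mat n n"
  shows "- spec_mat n U d = spec_mat n U (\<lambda>i. - d i)"
  using U by (intro eq_matI) (auto simp: index_spec_mat sum_negf)

lemma spec_mat_minus:
  assumes U: "U \<in> carrier_mat n n"
  shows "spec_mat n U d - spec_mat n U e = spec_mat n U (\<lambda>i. d i - e i)"
  using U by (intro eq_matI) (auto simp: index_spec_mat sum_subtractf algebra_simps)

lemma mat_tr_add:
  "A \<in> carrier_mat n n \<Longrightarrow> B \<in> carrier_mat n n \<Longrightarrow> mat_tr n (A + B) = mat_tr n A + mat_tr n B"
  by (simp add: mat_tr_def sum.distrib)

lemma mat_tr_minus:
  "A \<in> carrier_mat n n \<Longrightarrow> B \<in> carrier_mat n n \<Longrightarrow> mat_tr n (A - B) = mat_tr n A - mat_tr n B"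
  by (simp add: mat_tr_def sum_subtractf)

lemma mat_tr_one_minus_mult:
  assumes P: "P \<in> carrier_mat n n" and Q: "Q \<in> carrier_mat n n"
  shows "mat_tr n ((1\<^sub>m n - P) * (1\<^sub>m n - Q)) =
    mat_tr n (1\<^sub>m n) - mat_tr n P - mat_tr n Q + mat_tr n (P * Q)"
proof -
  have P': "1\<^sub>m n - P \<in> carrier_mat n n" using P by (rule minus_carrier_mat)
  have "(1\<^sub>m n - P) * (1\<^sub>m n - Q) = (1\<^sub>m n - P) * 1\<^sub>m n - (1\<^sub>m n - P) * Q"
    by (rule mult_minus_distrib_mat[OF P' one_carrier_mat Q])
  also have "(1\<^sub>m n - P) * Q = 1\<^sub>m n * Q - P * Q"
    by (rule minus_mult_distrib_mat[OF one_carrier_mat P Q])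
  finally have "(1\<^sub>m n - P) * (1\<^sub>m n - Q) = (1\<^sub>m n - P) - (Q - P * Q)"
    using right_mult_one_mat[OF P'] left_mult_one_mat[OF Q] by simp
  moreover have "P * Q \<in> carrier_mat n n" using P Q by (rule mult_carrier_mat)
  ultimately show ?thesis
    using P Q P' by (simp add: mat_tr_minus minus_carrier_mat)
qed

theorem theorem3:
  fixes n :: nat and A B :: "complex mat"
  assumes "psd_mat n A" and "psd_mat n B"
  defines "C \<equiv> mat_sqrt n (mat_sqrt n A * B * mat_sqrt n A)"
  shows "Re (mat_tr n (mat_exp n (- A) * mat_exp n (- B)))
           \<le> Re (mat_tr n (mat_exp n (- A) + mat_exp n (- B)))
             + Re (mat_tr n (mat_exp n (- (2 \<cdot>\<^sub>m C)) - 2 \<cdot>\<^sub>m mat_exp n (- C)))"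
proof -
  obtain U a where U: "unitary_mat n U" and A: "A = spec_mat n U a" and a: "\<And>i. i < n \<Longrightarrow> 0 \<le> a i"
    using psd_spectral[OF assms(1)] by metis
  obtain V b where V: "unitary_mat n V" and B: "B = spec_mat n V b" and b: "\<And>i. i < n \<Longrightarrow> 0 \<le> b i"
    using psd_spectral[OF assms(2)] by metis
  note cU = unitary_carrier[OF U] and cV = unitary_carrier[OF V]
  note ac = assoc_mult_mat[of _ n n _ n _ n] mult_carrier_mat[of _ n n _ n]
  define R where "R = spec_mat n U (\<lambda>i. sqrt (a i))"
  define S where "S = spec_mat n V (\<lambda>i. sqrt (b i))"
  have car: "R \<in> carrier_mat n n" "S \<in> carrier_mat n n" using cU cV by (auto simp: R_def S_def)
  have adj: "R\<^sup>\<dagger> = R" "S\<^sup>\<dagger> = S" using cU cV by (auto simp: R_def S_def spec_mat_adjoint)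
  have SS: "S * S = B"
    unfolding S_def B spec_mat_mult[OF V] by (rule spec_mat_cong[OF cV]) (use b in auto)
  have SR: "S * R \<in> carrier_mat n n" using car by auto
  have "(S * R)\<^sup>\<dagger> * (S * R) = R * ((S * S) * R)"
    using car by (simp add: adjoint_mult[of _ n n _ n] adj ac)
  then obtain W x where W: "unitary_mat n W" and RBR: "R * (B * R) = spec_mat n W x"
    and x: "\<And>i. i < n \<Longrightarrow> 0 \<le> x i" and xm: "\<And>i j. i \<le> j \<Longrightarrow> j < n \<Longrightarrow> x j \<le> x i"
    using gram_spectral_decomposition[OF SR] unfolding SS by metis
  note cW = unitary_carrier[OF W]
  define c where "c i = sqrt (x i)" for i
  have "R * B * R = spec_mat n W x"
    unfolding RBR[symmetric] using car cV by (simp add: B ac)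
  moreover have sA: "mat_sqrt n A = R"
    unfolding A R_def by (rule mat_sqrt_spec[OF U a])
  ultimately have C: "C = spec_mat n W c"
    using sA mat_sqrt_spec[of n W x, OF W] x by (simp add: C_def c_def[abs_def])
  interpret spectral_pair n U V W a b c
  proof
    have "spec_mat n W (\<lambda>i. (c i)\<^sup>2) = spec_mat n W x"
      by (rule spec_mat_cong[OF cW]) (use x in \<open>auto simp: c_def\<close>)
    thus "spec_mat n U (\<lambda>i. sqrt (a i)) * (spec_mat n V b * spec_mat n U (\<lambda>i. sqrt (a i))) =
        spec_mat n W (\<lambda>i. (c i)\<^sup>2)"
      using RBR by (simp add: R_def B)
  qed (use U V W a b x xm in \<open>auto simp: c_def\<close>)
  define P where "P = mat_exp n (- A)"
  define Q where "Q = mat_exp n (- B)"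
  have P: "P = spec_mat n U (\<lambda>i. exp (- a i))" and Q: "Q = spec_mat n V (\<lambda>i. exp (- b i))"
    by (simp_all add: P_def Q_def A B spec_mat_uminus[OF cU] spec_mat_uminus[OF cV] mat_exp_spec U V)
  have cP: "P \<in> carrier_mat n n" and cQ: "Q \<in> carrier_mat n n" using cU cV by (auto simp: P Q)
  have FA: "FA one_minus_exp = 1\<^sub>m n - P"
    unfolding P FA_def spec_mat_one[OF U, symmetric] spec_mat_minus[OF cU] by (simp add: one_minus_exp_def)
  have FB: "FB one_minus_exp = 1\<^sub>m n - Q"
    unfolding Q FB_def spec_mat_one[OF V, symmetric] spec_mat_minus[OF cV] by (simp add: one_minus_exp_def)
  have "mat_tr n (FA one_minus_exp * FB one_minus_exp) = mat_tr n (1\<^sub>m n) - mat_tr n P - mat_tr n Q + mat_tr n (P * Q)"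
    unfolding FA FB by (rule mat_tr_one_minus_mult[OF cP cQ])
  hence "mat_tr n (FA one_minus_exp * FB one_minus_exp) = of_nat n - mat_tr n P - mat_tr n Q + mat_tr n (P * Q)"
    by (simp add: mat_tr_def)
  moreover have "Re (mat_tr n (FA one_minus_exp * FB one_minus_exp)) \<le> (\<Sum>j<n. (one_minus_exp (c j))\<^sup>2)"
    by (rule trace_dominated[OF _ dominated_one_minus_exp]) (simp add: one_minus_exp_def)
  moreover have "mat_tr n (mat_exp n (- (2 \<cdot>\<^sub>m C)) - 2 \<cdot>\<^sub>m mat_exp n (- C)) =
      of_real (\<Sum>j<n. exp (- (2 * c j)) - 2 * exp (- c j))"
  proof -
    have "mat_exp n (- (2 \<cdot>\<^sub>m C)) - 2 \<cdot>\<^sub>m mat_exp n (- C) =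
        spec_mat n W (\<lambda>j. exp (- (2 * c j)) - 2 * exp (- c j))"
      using spec_mat_smult[OF cW, of 2]
      by (simp add: C spec_mat_uminus[OF cW] mat_exp_spec[OF W] spec_mat_minus[OF cW])
    thus ?thesis by (simp only: trace_spec[OF W])
  qed
  moreover have "(\<Sum>j<n. (one_minus_exp (c j))\<^sup>2) = real n + (\<Sum>j<n. exp (- (2 * c j)) - 2 * exp (- c j))"
  proof -
    have "exp (- (2 * t)) = exp (- t) * exp (- t)" for t :: real
      by (simp flip: exp_add)
    hence "(one_minus_exp (c j))\<^sup>2 = 1 + (exp (- (2 * c j)) - 2 * exp (- c j))" for j
      by (simp add: one_minus_exp_def power2_eq_square left_diff_distrib right_diff_distrib)
    thus ?thesis by (simp add: sum.distrib)
  qed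
  ultimately show ?thesis
    using cP cQ by (simp add: mat_tr_add flip: P_def Q_def)
qed

end
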